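(* Let $f:\mathbb{E}\to\mathbb{R}$ be convex and $p$-times differentiable, $p\ge 2$, with a minimizer $x^*$, and let $\nu\in[0,1]$ satisfy $H_{f,p}(\nu)<+\infty$. Let $x_0\in\mathbb{E}$ and suppose $\max_{x\in\mathcal{L}(x_0)}\|x-x^*\|\le D_0$ for some $D_0\in(1,+\infty)$, where $\mathcal{L}(x_0)=\{x\in\mathbb{E}: f(x)\le f(x_0)\}$. Let $\{x_t\}_{t=0}^{T}$ be generated by Algorithm 1 (described in the context) such that, for $t=0,\ldots,T$, $$\|\nabla f(x_{t,i}^{+})\|_*>\epsilon,\qquad i=0,\ldots,i_t.$$ Let $m$ be the first iteration number such that $$f(x_m)-f(x^* )\le 4[8(p+1)!]^{p+\alpha-1}\max\{H_0,N_\nu(\epsilon)\}D_0^{p+\alpha},$$ and assume $m<T$. If $T=m+3s$ for some integer $s\ge 1$, then $$g_T^*\equiv\min_{0\le t\le T}\|\nabla f(x_t)\|_*\le 2\left[\frac{288\,p\,(p+1)!\,D_0}{T-m}\right]^{p+\alpha-1}\max\{H_0,N_\nu(\epsilon)\}.$$ Consequently, $$T<m+\kappa_1^{(\nu)}\,[288\,p\,(p+1)!\,D_0]\,\epsilon^{-\frac{1}{p+\nu-1}},$$ where $$\kappa_1^{(\nu)}=\begin{cases}\left(2\max\left\{H_0,\frac{3H_{f,p}(\nu)}{2},3\theta(p-1)!\right\}\right)^{\frac{1}{p+\nu-1}},&\text{if }\nu\text{ is known},\\[4pt] \left(2\max\left\{H_0,\theta,\left(\frac{3H_{f,p}(\nu)}{2}\right)^{\frac{p}{p+\nu-1}}4^{\frac{1-\nu}{p+\nu-1}}\right\}\right)^{\frac1p},&\text{if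 }\nu\text{ is unknown}.\end{cases}$$
   Context: **Notation.** $\mathbb{E}$ is a finite-dimensional real vector space with dual $\mathbb{E}^*$, $\langle s,x\rangle$ is the value of $s\in\mathbb{E}^*$ at $x\in\mathbb{E}$, $B:\mathbb{E}\to\mathbb{E}^*$ is a fixed self-adjoint positive definite operator, $\|x\|=\langle Bx,x\rangle^{1/2}$ and $\|s\|_*=\langle s,B^{-1}s\rangle^{1/2}$. $D^if(x)[h]^i$ is the $i$th directional derivative of $f$ at $x$ along $h$ (taken $i$ times); the norm of a symmetric $p$-linear form $A$ is $\|A\|=\max\{|A[h_1,\ldots,h_p]|:\|h_i\|\le1\}$. The Hölder constants are $$H_{f,p}(\nu)=\sup_{x\ne y}\frac{\|D^pf(x)-D^pf(y)\|}{\|x-y\|^\nu},\quad 0\le\nu\le1.$$ Taylor polynomial: $\Phi_{x,p}(y)=f(x)+\sum_{i=1}^p\frac{1}{i!}D^if(x)[y-x]^i$. Model: $\Omega^{(\alpha)}_{x,p,H}(y)=\Phi_{x,p}(y)+\frac{H}{p!}\|y-x\|^{p+\alpha}$, $\alpha\in[0,1]$. **Parameter $\alpha$.** $\alpha=\nu$ if "$\nu$ is known" and $\alpha=1$ if "$\nu$ is unknown" (two cases, both covered). **Algorithm 1.** Step 0: choose $x_0\in\mathbb{E}$, $H_0>0$, $\theta\ge0$, $\epsilon\in(0,1)$; set $t:=0$. Step 1: if $\|\nabla f(x_t)\|_*\le\epsilon$, stop. Step 2: set $i:=0$. Step 2.1: compute an approximate solution $x_{t,i}^+$ of $\min_{y\in\mathbb{E}}\Omega^{(\alpha)}_{x_t,p,2^iH_t}(y)$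 such that $$\Omega^{(\alpha)}_{x_t,p,2^iH_t}(x_{t,i}^+)\le f(x_t)\quad\text{and}\quad\|\nabla\Omega^{(\alpha)}_{x_t,p,2^iH_t}(x_{t,i}^+)\|_*\le\theta\|x_{t,i}^+-x_t\|^{p+\alpha-1}.$$ Step 2.2: if either $\|\nabla f(x_{t,i}^+)\|_*\le\epsilon$ or $$f(x_t)-f(x_{t,i}^+)\ge\frac{1}{8(p+1)!(2^iH_t)^{\frac{1}{p+\alpha-1}}}\|\nabla f(x_{t,i}^+)\|_*^{\frac{p+\alpha}{p+\alpha-1}},$$ set $i_t:=i$ and go to Step 3; otherwise set $i:=i+1$ and go to Step 2.1. Step 3: set $x_{t+1}=x_{t,i_t}^+$ and $H_{t+1}=2^{i_t-1}H_t$. Step 4: set $t:=t+1$ and go to Step 1. **The quantity $N_\nu(\epsilon)$.** $$N_\nu(\epsilon)=\begin{cases}\max\left\{\frac{3H_{f,p}(\nu)}{2},3\theta(p-1)!\right\},&\nu\text{ known},\\[4pt]\max\left\{\theta,\left(\frac{3H_{f,p}(\nu)}{2}\right)^{\frac{p}{p+\nu-1}}4^{\frac{1-\nu}{p+\nu-1}}\right\}\epsilon^{-\frac{1-\nu}{p+\nu-1}},&\nu\text{ unknown}.\end{cases}$$ *)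

theory Defs
  imports "HOL-Analysis.Analysis"
begin

text \<open>
  The space \<open>E\<close> is a type of class \<open>euclidean_space\<close>, used only as a finite-dimensional real
  vector space with its topology: all norms below are taken with respect to the operator \<open>B\<close>, not
  the inner product of the class.  The dual of \<open>E\<close> is the type of (bounded) linear functionals.
\<close>

definition self_adjoint_pos_def :: "('a::euclidean_space \<Rightarrow> 'a \<Rightarrow>\<^sub>L real) \<Rightarrow> bool" where
  "self_adjoint_pos_def B \<longleftrightarrow>
     linear B \<and>
     (\<forall>x y. blinfun_apply (B x) y = blinfun_apply (B y) x) \<and>
     (\<forall>x. x \<noteq> 0 \<longrightarrow> blinfun_apply (B x) x > 0)"

definition pnorm :: "('a::euclidean_space \<Rightarrow> 'a \<Rightarrow>\<^sub>L real) \<Rightarrow> 'a \<Rightarrow> real" where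
  "pnorm B x = sqrt (blinfun_apply (B x) x)"

definition dnorm :: "('a::euclidean_space \<Rightarrow> 'a \<Rightarrow>\<^sub>L real) \<Rightarrow> ('a \<Rightarrow>\<^sub>L real) \<Rightarrow> real" where
  "dnorm B s = sqrt (blinfun_apply s (inv B s))"

definition grad :: "('a::euclidean_space \<Rightarrow> real) \<Rightarrow> 'a \<Rightarrow> 'a \<Rightarrow>\<^sub>L real" where
  "grad f x = Blinfun (frechet_derivative f (at x))"

text \<open>
  \<open>Dform f [h\<^sub>1, \<dots>, h\<^sub>k] x\<close> is \<open>D\<^sup>k f(x)[h\<^sub>1, \<dots>, h\<^sub>k]\<close>; the order of differentiation is the length
  of the list.
\<close>

primrec Dform :: "('a::euclidean_space \<Rightarrow> real) \<Rightarrow> 'a list \<Rightarrow> 'a \<Rightarrow> real" where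
  "Dform f [] = f"
| "Dform f (h # hs) = (\<lambda>x. frechet_derivative (Dform f hs) (at x) h)"

text \<open>
  Since \<open>E\<close> is finite-dimensional, the map \<open>x \<mapsto> D\<^sup>k f(x)\<close> into the \<open>k\<close>-linear forms is
  (Frechet) differentiable iff its evaluations at all tuples of directions are.
\<close>

definition times_differentiable :: "nat \<Rightarrow> ('a::euclidean_space \<Rightarrow> real) \<Rightarrow> bool" where
  "times_differentiable p f \<longleftrightarrow>
     (\<forall>hs x. length hs < p \<longrightarrow> Dform f hs differentiable (at x))"

definition form_norm ::
  "('a::euclidean_space \<Rightarrow> 'a \<Rightarrow>\<^sub>L real) \<Rightarrow> nat \<Rightarrow> ('a list \<Rightarrow> real) \<Rightarrow> real" where
  "form_norm B p A = Sup {\<bar>A hs\<bar> | hs. length hs = p \<and> (\<forall>h\<in>set hs. pnorm B h \<le> 1)}"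

definition holder_const ::
  "('a::euclidean_space \<Rightarrow> 'a \<Rightarrow>\<^sub>L real) \<Rightarrow> ('a \<Rightarrow> real) \<Rightarrow> nat \<Rightarrow> real \<Rightarrow> ennreal" where
  "holder_const B f p \<nu> =
     (SUP (x, y)\<in>{(x, y). x \<noteq> y}.
        ennreal (form_norm B p (\<lambda>hs. Dform f hs x - Dform f hs y) / pnorm B (x - y) powr \<nu>))"

definition taylor_poly :: "('a::euclidean_space \<Rightarrow> real) \<Rightarrow> nat \<Rightarrow> 'a \<Rightarrow> 'a \<Rightarrow> real" where
  "taylor_poly f p x y = f x + (\<Sum>i=1..p. 1 / fact i * Dform f (replicate i (y - x)) x)"

definition reg_model ::
  "('a::euclidean_space \<Rightarrow> 'a \<Rightarrow>\<^sub>L real) \<Rightarrow> ('a \<Rightarrow> real) \<Rightarrow> real \<Rightarrow> nat \<Rightarrow> real \<Rightarrow> 'a \<Rightarrow> 'a \<Rightarrow> real" where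
  "reg_model B f \<alpha> p H x y =
     taylor_poly f p x y + H / fact p * pnorm B (y - x) powr (real p + \<alpha>)"

text \<open>In what follows the Boolean \<open>known\<close> says whether \<open>\<nu>\<close> is known.\<close>

definition alpha :: "bool \<Rightarrow> real \<Rightarrow> real" where
  "alpha known \<nu> = (if known then \<nu> else 1)"

definition approx_solution ::
  "('a::euclidean_space \<Rightarrow> 'a \<Rightarrow>\<^sub>L real) \<Rightarrow> ('a \<Rightarrow> real) \<Rightarrow> real \<Rightarrow> nat \<Rightarrow> real \<Rightarrow> real \<Rightarrow> 'a \<Rightarrow> 'a \<Rightarrow> bool" where
  "approx_solution B f \<alpha> p \<theta> H x xp \<longleftrightarrow>
     reg_model B f \<alpha> p H x xp \<le> f x \<and>
     dnorm B (grad (reg_model B f \<alpha> p H x) xp) \<le> \<theta> * pnorm B (xp - x) powr (real p + \<alpha> - 1)"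

definition accepted ::
  "('a::euclidean_space \<Rightarrow> 'a \<Rightarrow>\<^sub>L real) \<Rightarrow> ('a \<Rightarrow> real) \<Rightarrow> real \<Rightarrow> nat \<Rightarrow> real \<Rightarrow> real \<Rightarrow> 'a \<Rightarrow> 'a \<Rightarrow> bool" where
  "accepted B f \<alpha> p \<epsilon> H x xp \<longleftrightarrow>
     dnorm B (grad f xp) \<le> \<epsilon> \<or>
     f x - f xp \<ge> 1 / (8 * fact (p + 1) * H powr (1 / (real p + \<alpha> - 1)))
                    * dnorm B (grad f xp) powr ((real p + \<alpha>) / (real p + \<alpha> - 1))"

text \<open>
  Iterations \<open>0, \<dots>, T\<close> of the algorithm, started at \<open>x\<^sub>0\<close> and \<open>H\<^sub>0\<close>, were carried out, none of them
  stopping at Step 1; they produced the iterates \<open>x t\<close>, the estimates \<open>H t\<close>, the trial points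
  \<open>xp t i\<close> and the numbers \<open>it t\<close> of the accepted trial points.  Nothing is said about the values
  \<open>xp t i\<close> with \<open>i > it t\<close>, which are never computed.
\<close>

definition algorithm_run ::
  "('a::euclidean_space \<Rightarrow> 'a \<Rightarrow>\<^sub>L real) \<Rightarrow> ('a \<Rightarrow> real) \<Rightarrow> real \<Rightarrow> nat \<Rightarrow> real \<Rightarrow> real \<Rightarrow> 'a \<Rightarrow> real \<Rightarrow> nat
    \<Rightarrow> (nat \<Rightarrow> 'a) \<Rightarrow> (nat \<Rightarrow> real) \<Rightarrow> (nat \<Rightarrow> nat \<Rightarrow> 'a) \<Rightarrow> (nat \<Rightarrow> nat) \<Rightarrow> bool" where
  "algorithm_run B f \<alpha> p \<theta> \<epsilon> x0 H0 T x H xp it \<longleftrightarrow>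
     x 0 = x0 \<and> H 0 = H0 \<and>
     (\<forall>t\<le>T.
        dnorm B (grad f (x t)) > \<epsilon> \<and>
        (\<forall>i\<le>it t. approx_solution B f \<alpha> p \<theta> (2 ^ i * H t) (x t) (xp t i)) \<and>
        (\<forall>i<it t. \<not> accepted B f \<alpha> p \<epsilon> (2 ^ i * H t) (x t) (xp t i)) \<and>
        accepted B f \<alpha> p \<epsilon> (2 ^ it t * H t) (x t) (xp t (it t)) \<and>
        x (Suc t) = xp t (it t) \<and>
        H (Suc t) = 2 powi (int (it t) - 1) * H t)"

definition N_const ::
  "('a::euclidean_space \<Rightarrow> 'a \<Rightarrow>\<^sub>L real) \<Rightarrow> ('a \<Rightarrow> real) \<Rightarrow> nat \<Rightarrow> real \<Rightarrow> bool \<Rightarrow> real \<Rightarrow> real \<Rightarrow> real" where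
  "N_const B f p \<nu> known \<theta> \<epsilon> =
     (let Hf = enn2real (holder_const B f p \<nu>) in
      if known then max (3 * Hf / 2) (3 * \<theta> * fact (p - 1))
      else max \<theta> ((3 * Hf / 2) powr (real p / (real p + \<nu> - 1))
                   * 4 powr ((1 - \<nu>) / (real p + \<nu> - 1)))
           * \<epsilon> powr (- ((1 - \<nu>) / (real p + \<nu> - 1))))"

definition kappa1 ::
  "('a::euclidean_space \<Rightarrow> 'a \<Rightarrow>\<^sub>L real) \<Rightarrow> ('a \<Rightarrow> real) \<Rightarrow> nat \<Rightarrow> real \<Rightarrow> bool \<Rightarrow> real \<Rightarrow> real \<Rightarrow> real" where
  "kappa1 B f p \<nu> known \<theta> H0 =
     (let Hf = enn2real (holder_const B f p \<nu>) in
      if known then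
        (2 * Max {H0, 3 * Hf / 2, 3 * \<theta> * fact (p - 1)}) powr (1 / (real p + \<nu> - 1))
      else
        (2 * Max {H0, \<theta>, (3 * Hf / 2) powr (real p / (real p + \<nu> - 1))
                            * 4 powr ((1 - \<nu>) / (real p + \<nu> - 1))}) powr (1 / real p))"

end

theory Submission
  imports Defs
begin

text \<open>
  Put \<open>q = p + \<alpha> - 1\<close> and \<open>M = max {H\<^sub>0, N\<^sub>\<nu>(\<epsilon>)}\<close>.

  The quantity \<open>N\<^sub>\<nu>(\<epsilon>)\<close> is chosen so that a trial point computed with a coefficient at least \<open>N\<^sub>\<nu>(\<epsilon>)\<close> is
  always accepted (\<open>trial_point_accepted\<close>). Indeed, the Hoelder condition makes the errors of the
  Taylor model and of its gradient at most \<open>L r\<^sup>p\<^sup>+\<^sup>\<nu> / p!\<close> and \<open>L r\<^sup>p\<^sup>+\<^sup>\<nu>\<^sup>-\<^sup>1 / (p-1)!\<close>, where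
  \<open>r\<close> is the length of the step and \<open>L\<close> the Hoelder constant, and a large coefficient lets the regularization outweigh them.
  Then \<open>f\<close> decreases by a multiple of \<open>r\<^sup>q\<^sup>+\<^sup>1\<close>, the new gradient is at most a multiple of \<open>r\<^sup>q\<close>, and
  eliminating \<open>r\<close> gives the acceptance test. As the line search doubles the coefficient, no accepted
  coefficient exceeds \<open>2M\<close> (\<open>algorithm_run_regularization_le\<close>), and every step decreases \<open>f\<close> by at
  least \<open>C g\<^sup>1\<^sup>+\<^sup>1\<^sup>/\<^sup>q\<close>, with \<open>g\<close> the norm of the new gradient and \<open>C = 1 / (8 (p+1)! (2M)\<^sup>1\<^sup>/\<^sup>q)\<close>.

  By convexity the gap \<open>\<delta> = f(x\<^sub>t) - f(x\<^sup>*)\<close> is at most \<open>D\<^sub>0 g\<close>. Hence \<open>\<delta>\<close> satisfies a recursion that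
  forces \<open>\<delta> = O(s\<^sup>-\<^sup>q)\<close> at the iteration \<open>m + 2s\<close> (\<open>sublinear_rate\<close>); the bound on the gap at iteration
  \<open>m\<close> is what starts this rate. The last \<open>s\<close> iterations must share the remaining gap, which bounds
  the smallest gradient among them (\<open>gradient_rate\<close>). All gradients exceed \<open>\<epsilon>\<close>, so this bound does too,
  and solving for \<open>T - m\<close> gives the bound on the number of iterations.

  The analysis rests on two facts about \<open>p\<close> times differentiable functions: the derivatives are
  symmetric multilinear forms (\<open>Dform_multilinear\<close>, \<open>Dform_symmetric\<close>), and Taylor's formula with
  Lagrange remainder holds along segments, for \<open>f\<close> and for its directional derivatives
  (\<open>Dform_taylor_remainder\<close>). Symmetry enters because the gradient of the Taylor polynomial has to
  be the Taylor polynomial of the gradient.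
\<close>

section \<open>The norm of \<open>B\<close> and its dual\<close>

lemma dual_pairing_sym:
  assumes "self_adjoint_pos_def B"
  shows "blinfun_apply (B x) y = blinfun_apply (B y) x"
  using assms unfolding self_adjoint_pos_def_def by blast

lemma dual_pairing_nonneg:
  assumes "self_adjoint_pos_def B"
  shows "0 \<le> blinfun_apply (B x) x"
proof (cases "x = 0")
  case True
  then show ?thesis by simp
next
  case False
  then show ?thesis using assms unfolding self_adjoint_pos_def_def by (simp add: less_imp_le)
qed

lemma pnorm_nonneg [simp]: "self_adjoint_pos_def B \<Longrightarrow> 0 \<le> pnorm B x"
  unfolding pnorm_def by (simp add: dual_pairing_nonneg)

lemma pnorm_zero [simp]: "pnorm B 0 = 0"
  unfolding pnorm_def by simp

lemma pnorm_pos: "self_adjoint_pos_def B \<Longrightarrow> x \<noteq> 0 \<Longrightarrow> 0 < pnorm B x"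
  unfolding pnorm_def self_adjoint_pos_def_def by simp

lemma pnorm_power2: "self_adjoint_pos_def B \<Longrightarrow> (pnorm B x)\<^sup>2 = blinfun_apply (B x) x"
  unfolding pnorm_def by (simp add: dual_pairing_nonneg)

lemma linear_B: "self_adjoint_pos_def B \<Longrightarrow> linear B"
  unfolding self_adjoint_pos_def_def by blast

lemma pnorm_scaleR:
  assumes "self_adjoint_pos_def B"
  shows "pnorm B (c *\<^sub>R x) = \<bar>c\<bar> * pnorm B x"
proof -
  have "blinfun_apply (B (c *\<^sub>R x)) (c *\<^sub>R x) = c\<^sup>2 * blinfun_apply (B x) x"
    by (simp add: linear_scale[OF linear_B[OF assms]] scaleR_blinfun.rep_eq blinfun.scaleR_right
        power2_eq_square)
  then show ?thesis unfolding pnorm_def by (simp add: real_sqrt_mult)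
qed

text \<open>The usual discriminant argument: the quadratic form of \<open>B\<close> is nonnegative at
  \<open>\<langle>By, y\<rangle> x - \<langle>Bx, y\<rangle> y\<close>.\<close>
lemma dual_pairing_Cauchy_Schwarz:
  assumes B: "self_adjoint_pos_def B"
  shows "\<bar>blinfun_apply (B x) y\<bar> \<le> pnorm B x * pnorm B y"
proof (cases "y = 0")
  case True
  then show ?thesis by simp
next
  case False
  define a where "a = blinfun_apply (B x) x"
  define b where "b = blinfun_apply (B x) y"
  define c where "c = blinfun_apply (B y) y"
  note lin = linear_B[OF B]
  have c: "c > 0" using B False unfolding c_def self_adjoint_pos_def_def by blast
  have "0 \<le> blinfun_apply (B (c *\<^sub>R x - b *\<^sub>R y)) (c *\<^sub>R x - b *\<^sub>R y)"
    by (rule dual_pairing_nonneg[OF B])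
  also have "\<dots> = c * (a * c - b\<^sup>2)"
    using dual_pairing_sym[OF B, of y x]
    by (simp add: linear_diff[OF lin] linear_scale[OF lin] minus_blinfun.rep_eq
        scaleR_blinfun.rep_eq blinfun.scaleR_right blinfun.diff_right a_def b_def c_def
        algebra_simps power2_eq_square)
  finally have "b\<^sup>2 \<le> a * c" using c by (simp add: zero_le_mult_iff)
  then have "sqrt (b\<^sup>2) \<le> sqrt (a * c)" by (rule real_sqrt_le_mono)
  then have "\<bar>b\<bar> \<le> sqrt a * sqrt c" by (simp add: real_sqrt_mult)
  then show ?thesis by (simp add: a_def b_def c_def pnorm_def)
qed

text \<open>In finite dimension the injective map \<open>B\<close> is onto: read off the values of \<open>B x\<close> on a basis.\<close>
lemma bij_B:
  fixes B :: "'a::euclidean_space \<Rightarrow> 'a \<Rightarrow>\<^sub>L real"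
  assumes B: "self_adjoint_pos_def B"
  shows "bij B"
proof -
  note lin = linear_B[OF B]
  define R where "R = (\<lambda>s :: 'a \<Rightarrow>\<^sub>L real. \<Sum>b\<in>Basis. blinfun_apply s b *\<^sub>R b)"
  have R_inner: "R s \<bullet> b = blinfun_apply s b" if "b \<in> Basis" for s b
    unfolding R_def using that by (simp add: inner_sum_left_Basis)
  have R_inj: "s = s'" if "R s = R s'" for s s'
    by (rule blinfun_euclidean_eqI) (metis R_inner that)
  have linR: "linear R"
    by (rule linearI) (auto simp: R_def plus_blinfun.rep_eq scaleR_blinfun.rep_eq
        scaleR_add_left sum.distrib scaleR_sum_right)
  have "x = 0" if "B x = 0" for x
  proof (rule ccontr)
    assume "x \<noteq> 0"
    then have "blinfun_apply (B x) x > 0" using B unfolding self_adjoint_pos_def_def by blast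
    then show False using that by simp
  qed
  then have injB: "inj B" using lin by (simp add: linear_injective_0)
  have linRB: "linear (R \<circ> B)" using lin linR by (rule linear_compose)
  have "inj (R \<circ> B)" using injB R_inj by (auto simp: inj_def)
  then have "surj (R \<circ> B)" using linRB linear_injective_imp_surjective by blast
  have "surj B"
  proof (rule surjI[of B "\<lambda>s. inv (R \<circ> B) (R s)"])
    fix s
    have "(R \<circ> B) (inv (R \<circ> B) (R s)) = R s"
      using \<open>surj (R \<circ> B)\<close> by (rule surj_f_inv_f)
    then show "B (inv (R \<circ> B) (R s)) = s" using R_inj by auto
  qed
  then show ?thesis using injB by (simp add: bij_def)
qed

lemma B_inv_B: "self_adjoint_pos_def B \<Longrightarrow> B (inv B s) = s"
  using bij_B by (metis bij_inv_eq_iff)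

lemma dnorm_eq_pnorm_inv: "self_adjoint_pos_def B \<Longrightarrow> dnorm B s = pnorm B (inv B s)"
  unfolding dnorm_def pnorm_def by (simp add: B_inv_B)

lemma dnorm_nonneg [simp]: "self_adjoint_pos_def B \<Longrightarrow> 0 \<le> dnorm B s"
  by (simp add: dnorm_eq_pnorm_inv)

lemma abs_apply_le_dnorm:
  assumes B: "self_adjoint_pos_def B"
  shows "\<bar>blinfun_apply s v\<bar> \<le> dnorm B s * pnorm B v"
  using dual_pairing_Cauchy_Schwarz[OF B, of "inv B s" v] 
  by (simp add: B_inv_B[OF B] dnorm_eq_pnorm_inv[OF B])

text \<open>The norm \<open>\<parallel>\<cdot>\<parallel>\<^sub>*\<close> is the dual norm, so a bound on it can be checked against test vectors; the
  critical one is \<open>B\<^sup>-\<^sup>1 s\<close>.\<close>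
lemma dnorm_leI:
  assumes B: "self_adjoint_pos_def B" and "0 \<le> K"
    and bound: "\<And>v. blinfun_apply s v \<le> K * pnorm B v"
  shows "dnorm B s \<le> K"
proof -
  define u where "u = inv B s"
  have "(pnorm B u)\<^sup>2 \<le> K * pnorm B u"
    using bound[of u] by (simp add: pnorm_power2[OF B] u_def B_inv_B[OF B])
  then have "pnorm B u \<le> K"
    using pnorm_nonneg[OF B, of u] \<open>0 \<le> K\<close> 
    by (metis less_eq_real_def mult_le_cancel_right_pos power2_eq_square)
  then show ?thesis by (simp add: dnorm_eq_pnorm_inv[OF B] u_def)
qed

lemma bounded_linear_B:
  assumes "self_adjoint_pos_def B"
  shows "bounded_linear B"
  using linear_B[OF assms] by (simp add: linear_conv_bounded_linear)

lemma continuous_on_pnorm: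
  assumes B: "self_adjoint_pos_def B"
  shows "continuous_on S (pnorm B)"
  unfolding pnorm_def
  by (intro continuous_intros bounded_linear.continuous_on[OF bounded_linear_B[OF B]])

lemma pnorm_le_norm:
  assumes B: "self_adjoint_pos_def B"
  obtains c where "c > 0" "\<And>x. pnorm B x \<le> c * norm x"
proof -
  obtain K where K: "K > 0" "\<And>x. norm (B x) \<le> norm x * K"
    using bounded_linear.pos_bounded[OF bounded_linear_B[OF B]] by blast
  have "pnorm B x \<le> sqrt K * norm x" for x
  proof -
    have "blinfun_apply (B x) x \<le> norm (B x) * norm x"
      by (metis abs_le_D1 norm_blinfun real_norm_def)
    also have "\<dots> \<le> norm x * K * norm x" by (intro mult_right_mono K) simp
    finally have "sqrt (blinfun_apply (B x) x) \<le> sqrt (K * (norm x)\<^sup>2)"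
      by (simp add: power2_eq_square ac_simps)
    then show ?thesis by (simp add: pnorm_def real_sqrt_mult)
  qed
  then show ?thesis using that[of "sqrt K"] K(1) by simp
qed

lemma norm_le_pnorm:
  fixes B :: "'a::euclidean_space \<Rightarrow> 'a \<Rightarrow>\<^sub>L real"
  assumes B: "self_adjoint_pos_def B"
  obtains c where "c > 0" "\<And>x. norm x \<le> c * pnorm B x"
proof -
  have "\<exists>x\<in>sphere (0::'a) 1. \<forall>y\<in>sphere 0 1. pnorm B x \<le> pnorm B y"
    by (rule continuous_attains_inf) (auto simp: continuous_on_pnorm[OF B])
  then obtain z :: 'a where z: "norm z = 1" "\<And>y. norm y = 1 \<Longrightarrow> pnorm B z \<le> pnorm B y"
    by auto
  have "z \<noteq> 0" using z(1) by auto
  then have pos: "pnorm B z > 0" by (rule pnorm_pos[OF B])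
  have "norm x \<le> (1 / pnorm B z) * pnorm B x" for x
  proof (cases "x = 0")
    case False
    have "pnorm B z \<le> pnorm B ((1 / norm x) *\<^sub>R x)" by (rule z(2)) (simp add: False)
    also have "\<dots> = pnorm B x / norm x" by (simp add: pnorm_scaleR[OF B])
    finally show ?thesis using pos False by (simp add: field_simps)
  qed simp
  then show ?thesis using that[of "1 / pnorm B z"] pos by simp
qed

section \<open>Symmetry of second derivatives\<close>

text \<open>The mean value theorem, applied to \<open>s \<mapsto> g(x + tk + sh) - g(x + sh)\<close>, turns the second
  difference into \<open>t\<close> times an increment of \<open>y \<mapsto> Dg(y)[h]\<close>; this function being differentiable at \<open>x\<close>, the increment is \<open>t\<close> times its
  derivative along \<open>k\<close>, up to \<open>o(t)\<close>.\<close>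
lemma second_difference_tendsto:
  fixes g :: "'a::euclidean_space \<Rightarrow> real"
  assumes g: "\<And>y. g differentiable (at y)"
    and b: "((\<lambda>y. frechet_derivative g (at y) h) has_derivative b') (at x)"
  shows "((\<lambda>t. (g (x + t *\<^sub>R h + t *\<^sub>R k) - g (x + t *\<^sub>R h) - g (x + t *\<^sub>R k) + g x) / t\<^sup>2)
          \<longlongrightarrow> b' k) (at_right 0)"
proof (rule tendstoI)
  fix e :: real assume "e > 0"
  define b where "b = (\<lambda>y. frechet_derivative g (at y) h)"
  have lin: "linear b'" using b has_derivative_linear by blast
  define N where "N = norm h + norm k"
  define e' where "e' = e / (2 * N + 1)"
  have N: "N \<ge> 0" by (simp add: N_def)
  have e': "e' > 0" using \<open>e > 0\<close> N by (simp add: e'_def)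
  obtain d where d: "d > 0" "\<And>y. norm (y - x) < d \<Longrightarrow> norm (b y - b x - b' (y - x)) \<le> e' * norm (y - x)"
    using b e' unfolding has_derivative_at_alt b_def by blast
  have deriv: "((\<lambda>s. g (z + s *\<^sub>R h)) has_real_derivative b (z + s *\<^sub>R h)) (at s)" for z s
  proof -
    have "(g has_derivative frechet_derivative g (at (z + s *\<^sub>R h))) (at (z + s *\<^sub>R h))"
      using g frechet_derivative_works by blast
    moreover have "((\<lambda>s. z + s *\<^sub>R h) has_derivative (\<lambda>u. u *\<^sub>R h)) (at s)"
      by (auto intro!: derivative_eq_intros)
    ultimately have "((\<lambda>s. g (z + s *\<^sub>R h)) has_derivative
           (\<lambda>u. frechet_derivative g (at (z + s *\<^sub>R h)) (u *\<^sub>R h))) (at s)"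
      using has_derivative_compose[of "\<lambda>s. z + s *\<^sub>R h" "\<lambda>u. u *\<^sub>R h" s UNIV g] by blast
    moreover have "linear (frechet_derivative g (at (z + s *\<^sub>R h)))"
      using g by (rule linear_frechet_derivative)
    ultimately show ?thesis
      unfolding has_field_derivative_def b_def by (simp add: linear_scale mult_commute_abs)
  qed
  have "dist ((g (x + t *\<^sub>R h + t *\<^sub>R k) - g (x + t *\<^sub>R h) - g (x + t *\<^sub>R k) + g x) / t\<^sup>2) (b' k) < e"
    if t: "0 < t" "t < d / (N + 1)" for t
  proof -
    define \<phi> where "\<phi> = (\<lambda>s. g ((x + t *\<^sub>R k) + s *\<^sub>R h) - g (x + s *\<^sub>R h))"
    have "\<exists>\<xi>. 0 < \<xi> \<and> \<xi> < t \<and>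
        \<phi> t - \<phi> 0 = (t - 0) * (b ((x + t *\<^sub>R k) + \<xi> *\<^sub>R h) - b (x + \<xi> *\<^sub>R h))"
      by (rule MVT2[OF t(1)]) (auto simp: \<phi>_def intro!: DERIV_diff deriv)
    then obtain \<xi> where \<xi>: "0 < \<xi>" "\<xi> < t"
      and mvt: "\<phi> t - \<phi> 0 = t * (b ((x + t *\<^sub>R k) + \<xi> *\<^sub>R h) - b (x + \<xi> *\<^sub>R h))" by auto
    have tN: "t * N < d" 
    proof -
      have "t * N \<le> t * (N + 1)" using t(1) by simp
      also have "\<dots> < d" using t(2) N by (simp add: field_simps)
      finally show ?thesis .
    qed
    have n1: "norm (t *\<^sub>R k + \<xi> *\<^sub>R h) \<le> t * N"
    proof -
      have "norm (t *\<^sub>R k + \<xi> *\<^sub>R h) \<le> t * norm k + \<xi> * norm h"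
        using norm_triangle_ineq[of "t *\<^sub>R k" "\<xi> *\<^sub>R h"] t(1) \<xi> by simp
      also have "\<dots> \<le> t * norm k + t * norm h" using \<xi> by (intro add_left_mono mult_right_mono) auto
      finally show ?thesis by (simp add: N_def algebra_simps)
    qed
    have n2: "norm (\<xi> *\<^sub>R h) \<le> t * N"
    proof -
      have "norm (\<xi> *\<^sub>R h) \<le> t * norm h" using \<xi> by (simp add: mult_right_mono)
      also have "\<dots> \<le> t * N" using t(1) by (simp add: N_def)
      finally show ?thesis .
    qed
    have r1: "\<bar>b (x + (t *\<^sub>R k + \<xi> *\<^sub>R h)) - b x - b' (t *\<^sub>R k + \<xi> *\<^sub>R h)\<bar> \<le> e' * (t * N)"
      using d(2)[of "x + (t *\<^sub>R k + \<xi> *\<^sub>R h)"] n1 tN mult_left_mono[OF n1, of e'] e'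
      by (simp only: add_diff_cancel_left' real_norm_def) linarith
    have r2: "\<bar>b (x + \<xi> *\<^sub>R h) - b x - b' (\<xi> *\<^sub>R h)\<bar> \<le> e' * (t * N)"
      using d(2)[of "x + \<xi> *\<^sub>R h"] n2 tN mult_left_mono[OF n2, of e'] e'
      by (simp only: add_diff_cancel_left' real_norm_def) linarith
    have "b' (t *\<^sub>R k + \<xi> *\<^sub>R h) - b' (\<xi> *\<^sub>R h) = t * b' k"
      by (simp add: linear_add[OF lin] linear_scale[OF lin])
    then have r3: "\<bar>(b ((x + t *\<^sub>R k) + \<xi> *\<^sub>R h) - b (x + \<xi> *\<^sub>R h)) - t * b' k\<bar> \<le> 2 * (e' * (t * N))"
      using r1 r2 by (simp add: add.assoc) 
    have "(g (x + t *\<^sub>R h + t *\<^sub>R k) - g (x + t *\<^sub>R h) - g (x + t *\<^sub>R k) + g x) = \<phi> t - \<phi> 0"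
      by (simp add: \<phi>_def algebra_simps)
    then have "(g (x + t *\<^sub>R h + t *\<^sub>R k) - g (x + t *\<^sub>R h) - g (x + t *\<^sub>R k) + g x) / t\<^sup>2 - b' k
        = ((b ((x + t *\<^sub>R k) + \<xi> *\<^sub>R h) - b (x + \<xi> *\<^sub>R h)) - t * b' k) / t"
      unfolding mvt using t(1) by (simp add: diff_divide_distrib power2_eq_square)
    also have "\<bar>\<dots>\<bar> \<le> 2 * (e' * (t * N)) / t"
      unfolding abs_divide abs_of_pos[OF t(1)]
      by (rule divide_right_mono[OF r3]) (use t(1) in simp)
    also have "\<dots> = e' * (2 * N)" using t(1) by simp
    also have "\<dots> < e" 
      using \<open>e > 0\<close> N by (simp add: e'_def field_simps)
    finally show ?thesis by (simp add: dist_real_def)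
  qed
  moreover have "\<forall>\<^sub>F t in at_right 0. 0 < t \<and> t < d / (N + 1)"
    using eventually_at_right_real[of 0 "d / (N + 1)"] d(1) N by (simp add: eventually_mono)
  ultimately show "\<forall>\<^sub>F t in at_right 0.
     dist ((g (x + t *\<^sub>R h + t *\<^sub>R k) - g (x + t *\<^sub>R h) - g (x + t *\<^sub>R k) + g x) / t\<^sup>2) (b' k) < e"
    by (auto elim: eventually_mono)
qed

text \<open>The second difference is symmetric in \<open>h\<close> and \<open>k\<close>, hence so is its limit. The \<open>p\<close>-th derivative
  of \<open>f\<close> may be discontinuous when \<open>\<nu> = 0\<close>, so symmetry has to come from mere existence.\<close>
lemma second_derivative_symmetric:
  fixes g :: "'a::euclidean_space \<Rightarrow> real"
  assumes g: "\<And>y. g differentiable (at y)"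
    and gg: "\<And>h. (\<lambda>y. frechet_derivative g (at y) h) differentiable (at x)"
  shows "frechet_derivative (\<lambda>y. frechet_derivative g (at y) h) (at x) k
       = frechet_derivative (\<lambda>y. frechet_derivative g (at y) k) (at x) h"
proof -
  have lim: "((\<lambda>t. (g (x + t *\<^sub>R h + t *\<^sub>R k) - g (x + t *\<^sub>R h) - g (x + t *\<^sub>R k) + g x) / t\<^sup>2)
          \<longlongrightarrow> frechet_derivative (\<lambda>y. frechet_derivative g (at y) h) (at x) k) (at_right 0)" for h k
    by (rule second_difference_tendsto[OF g frechet_derivative_works[THEN iffD1, OF gg]])
  have "(\<lambda>t. (g (x + t *\<^sub>R h + t *\<^sub>R k) - g (x + t *\<^sub>R h) - g (x + t *\<^sub>R k) + g x) / t\<^sup>2)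
      = (\<lambda>t. (g (x + t *\<^sub>R k + t *\<^sub>R h) - g (x + t *\<^sub>R k) - g (x + t *\<^sub>R h) + g x) / t\<^sup>2)"
    by (simp add: algebra_simps)
  then show ?thesis
    using tendsto_unique[OF _ lim[of h k]] lim[of k h] by simp
qed

section \<open>Multilinear forms\<close>

text \<open>Arguments are given as lists, as in \<^const>\<open>Dform\<close>; only lists of length \<open>n\<close> matter. Symmetry
  is invariance under swaps of neighbours, the form in which it is inherited by derivatives.\<close>
definition multilinear_form :: "nat \<Rightarrow> ('a::euclidean_space list \<Rightarrow> real) \<Rightarrow> bool" where
  "multilinear_form n A \<longleftrightarrow>
     (\<forall>as bs. length as + length bs + 1 = n \<longrightarrow> linear (\<lambda>h. A (as @ h # bs)))"

definition symmetric_form :: "nat \<Rightarrow> ('a::euclidean_space list \<Rightarrow> real) \<Rightarrow> bool" where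
  "symmetric_form n A \<longleftrightarrow>
     (\<forall>as bs h k. length as + length bs + 2 = n \<longrightarrow> A (as @ h # k # bs) = A (as @ k # h # bs))"

lemma multilinear_form_Cons:
  assumes "multilinear_form (Suc n) A"
  shows "multilinear_form n (\<lambda>hs. A (h # hs))"
  unfolding multilinear_form_def
proof (intro allI impI)
  fix as bs :: "'a list" assume "length as + length bs + 1 = n"
  then have "linear (\<lambda>k. A ((h # as) @ k # bs))"
    using assms unfolding multilinear_form_def by (metis add_Suc length_Cons)
  then show "linear (\<lambda>k. A (h # as @ k # bs))" by simp
qed

lemma symmetric_form_Cons:
  assumes "symmetric_form (Suc n) A"
  shows "symmetric_form n (\<lambda>hs. A (h # hs))"
  unfolding symmetric_form_def
proof (intro allI impI)
  fix as bs :: "'a list" and h1 h2 assume "length as + length bs + 2 = n"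
  then have "length (h # as) + length bs + 2 = Suc n" by simp
  then have "A ((h # as) @ h1 # h2 # bs) = A ((h # as) @ h2 # h1 # bs)"
    using assms unfolding symmetric_form_def by blast
  then show "A (h # as @ h1 # h2 # bs) = A (h # as @ h2 # h1 # bs)" by simp
qed

lemma multilinear_form_diff:
  assumes "multilinear_form n A" "multilinear_form n A'"
  shows "multilinear_form n (\<lambda>hs. A hs - A' hs)"
  using assms unfolding multilinear_form_def by (auto intro: linear_compose_sub)

lemma multilinear_form_linear_head:
  assumes "multilinear_form (Suc n) A" "length hs = n"
  shows "linear (\<lambda>h. A (h # hs))"
  using assms(1)[unfolded multilinear_form_def, rule_format, of "[]" hs] assms(2) by simp

lemma multilinear_form_expand_head:
  fixes A :: "'a::euclidean_space list \<Rightarrow> real"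
  assumes "multilinear_form (Suc n) A" "length hs = n"
  shows "A (h # hs) = (\<Sum>b\<in>Basis. (h \<bullet> b) * A (b # hs))"
proof -
  note lin = multilinear_form_linear_head[OF assms]
  have "A (h # hs) = A ((\<Sum>b\<in>Basis. (h \<bullet> b) *\<^sub>R b) # hs)" by (simp add: euclidean_representation)
  also have "\<dots> = (\<Sum>b\<in>Basis. (h \<bullet> b) * A (b # hs))"
    by (simp add: linear_sum[OF lin] linear_scale[OF lin])
  finally show ?thesis .
qed

text \<open>The scalings may differ from one argument to the next, so that each argument can be
  normalized separately.\<close>
lemma multilinear_form_scale:
  assumes "multilinear_form (length hs) A"
  shows "A (map (\<lambda>h. c h *\<^sub>R g h) hs) = prod_list (map c hs) * A (map g hs)"
  using assms
proof (induction hs arbitrary: A)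
  case (Cons h hs)
  have "A (map (\<lambda>h. c h *\<^sub>R g h) (h # hs)) = c h * A (g h # map (\<lambda>h. c h *\<^sub>R g h) hs)"
  proof -
    have "linear (\<lambda>k. A (k # map (\<lambda>h. c h *\<^sub>R g h) hs))"
      using Cons.prems by (intro multilinear_form_linear_head[of "length hs"]) auto
    from linear_scale[OF this, of "c h" "g h"] show ?thesis by simp
  qed
  also have "A (g h # map (\<lambda>h. c h *\<^sub>R g h) hs) = prod_list (map c hs) * A (g h # map g hs)"
    using Cons.prems by (intro Cons.IH[of "\<lambda>hs. A (g h # hs)"] multilinear_form_Cons) simp
  finally show ?case by simp
qed simp

text \<open>The norm of a form is a real supremum, which is meaningful only for a set bounded above.
  Boundedness follows by expanding one argument after the other in a basis.\<close>
lemma multilinear_form_bounded: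
  fixes A :: "'a::euclidean_space list \<Rightarrow> real"
  assumes "multilinear_form n A"
  shows "\<exists>K\<ge>0. \<forall>hs. length hs = n \<longrightarrow> \<bar>A hs\<bar> \<le> K * prod_list (map norm hs)"
  using assms
proof (induction n arbitrary: A)
  case 0
  then show ?case by (intro exI[of _ "\<bar>A []\<bar>"]) simp
next
  case (Suc n)
  have "\<forall>b. \<exists>K\<ge>0. \<forall>hs. length hs = n \<longrightarrow> \<bar>A (b # hs)\<bar> \<le> K * prod_list (map norm hs)"
    using Suc.IH multilinear_form_Cons[OF Suc.prems] by blast
  then obtain K where K: "\<And>b. K b \<ge> 0"
    "\<And>b hs. length hs = n \<Longrightarrow> \<bar>A (b # hs)\<bar> \<le> K b * prod_list (map norm hs)" by metis
  have "\<bar>A hs\<bar> \<le> (\<Sum>b\<in>Basis. K b) * prod_list (map norm hs)" if "length hs = Suc n" for hs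
  proof -
    obtain h hs' where hs: "hs = h # hs'" "length hs' = n"
      using \<open>length hs = Suc n\<close> by (cases hs) auto
    have "\<bar>A hs\<bar> \<le> (\<Sum>b\<in>Basis. \<bar>(h \<bullet> b) * A (b # hs')\<bar>)"
      unfolding hs(1) multilinear_form_expand_head[OF Suc.prems hs(2), of h] by (rule sum_abs)
    also have "\<dots> \<le> (\<Sum>b\<in>Basis. norm h * (K b * prod_list (map norm hs')))"
      using K hs(2) by (intro sum_mono) (auto simp: abs_mult intro!: mult_mono Basis_le_norm)
    also have "\<dots> = (\<Sum>b\<in>Basis. K b) * prod_list (map norm hs)"
      by (simp add: hs(1) sum_distrib_right sum_distrib_left ac_simps)
    finally show ?thesis .
  qed
  moreover have "(\<Sum>b\<in>(Basis :: 'a set). K b) \<ge> 0" using K(1) by (simp add: sum_nonneg)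
  ultimately show ?case by blast
qed

lemma symmetric_form_move:
  assumes "symmetric_form n A" "length as + a + 1 = n"
  shows "A (as @ v # replicate a h) = A (as @ replicate a h @ [v])"
  using assms
proof (induction a arbitrary: as)
  case (Suc a)
  have "A (as @ v # replicate (Suc a) h) = A (as @ h # v # replicate a h)"
    using Suc.prems unfolding symmetric_form_def by simp
  also have "\<dots> = A ((as @ [h]) @ v # replicate a h)" by simp
  also have "\<dots> = A ((as @ [h]) @ replicate a h @ [v])"
    using Suc.prems by (intro Suc.IH) auto
  finally show ?case by simp
qed simp

text \<open>The product rule for \<open>A[h, \<dots>, h]\<close>: expanding the first argument in a basis exhibits the
  diagonal as a sum of products of a coordinate and a diagonal of smaller order.\<close>
lemma has_derivative_diagonal:
  fixes A :: "'a::euclidean_space list \<Rightarrow> real"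
  assumes "multilinear_form n A" "symmetric_form n A"
  shows "((\<lambda>h. A (replicate n h)) has_derivative
           (\<lambda>v. real n * A (replicate (n - 1) h @ [v]))) (at h)"
  using assms
proof (induction n arbitrary: A)
  case (Suc n)
  have IH: "((\<lambda>h. A (b # replicate n h)) has_derivative
             (\<lambda>v. real n * A (b # replicate (n - 1) h @ [v]))) (at h)" for b
    using Suc.IH[of "\<lambda>hs. A (b # hs)"] multilinear_form_Cons[OF Suc.prems(1)]
      symmetric_form_Cons[OF Suc.prems(2)] by simp
  have "((\<lambda>h. \<Sum>b\<in>Basis. (h \<bullet> b) * A (b # replicate n h)) has_derivative
      (\<lambda>v. \<Sum>b\<in>Basis. (h \<bullet> b) * (real n * A (b # replicate (n - 1) h @ [v]))
                      + (v \<bullet> b) * A (b # replicate n h))) (at h)"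
    by (intro has_derivative_sum has_derivative_mult IH has_derivative_inner_left has_derivative_ident)
  moreover have "(\<lambda>h. \<Sum>b\<in>Basis. (h \<bullet> b) * A (b # replicate n h)) = (\<lambda>h. A (replicate (Suc n) h))"
    by (intro ext, subst multilinear_form_expand_head[OF Suc.prems(1), symmetric]) simp_all
  moreover have "(\<Sum>b\<in>Basis. (h \<bullet> b) * (real n * A (b # replicate (n - 1) h @ [v]))
                      + (v \<bullet> b) * A (b # replicate n h))
      = real (Suc n) * A (replicate (Suc n - 1) h @ [v])" for v
  proof -
    have "(\<Sum>b\<in>Basis. (v \<bullet> b) * A (b # replicate n h)) = A (replicate n h @ [v])"
      using multilinear_form_expand_head[OF Suc.prems(1), of "replicate n h" v]
        symmetric_form_move[OF Suc.prems(2), of "[]" n v h] by simp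
    moreover have "(\<Sum>b\<in>Basis. (h \<bullet> b) * (real n * A (b # replicate (n - 1) h @ [v])))
        = real n * A (replicate n h @ [v])"
    proof (cases n)
      case (Suc k)
      have "(\<Sum>b\<in>Basis. (h \<bullet> b) * A (b # replicate k h @ [v])) = A (h # replicate k h @ [v])"
        using multilinear_form_expand_head[OF Suc.prems(1), of "replicate k h @ [v]" h] Suc by simp
      moreover have "(\<Sum>b\<in>Basis. (h \<bullet> b) * (real n * A (b # replicate k h @ [v])))
          = real n * (\<Sum>b\<in>Basis. (h \<bullet> b) * A (b # replicate k h @ [v]))"
        by (simp add: sum_distrib_left mult.left_commute)
      ultimately show ?thesis using Suc by simp
    qed simp
    ultimately show ?thesis by (simp add: sum.distrib algebra_simps)
  qed
  ultimately show ?case by simp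
qed simp

text \<open>Homogeneity reduces to arguments in the unit ball. Since \<open>1 / 0 = 0\<close>, the normalization
  \<open>h \<mapsto> h / \<parallel>h\<parallel>\<close> sends \<open>0\<close> to \<open>0\<close>, and \<open>h = \<parallel>h\<parallel> (h / \<parallel>h\<parallel>)\<close> holds for every \<open>h\<close>.\<close>
lemma form_norm_bound:
  fixes B :: "'a::euclidean_space \<Rightarrow> 'a \<Rightarrow>\<^sub>L real"
  assumes B: "self_adjoint_pos_def B" and A: "multilinear_form n A" and hs: "length hs = n"
  shows "\<bar>A hs\<bar> \<le> form_norm B n A * prod_list (map (pnorm B) hs)"
proof -
  let ?S = "{\<bar>A hs\<bar> | hs. length hs = n \<and> (\<forall>h\<in>set hs. pnorm B h \<le> 1)}"
  obtain K where K: "K \<ge> 0" "\<And>hs. length hs = n \<Longrightarrow> \<bar>A hs\<bar> \<le> K * prod_list (map norm hs)"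
    using multilinear_form_bounded[OF A] by blast
  obtain c where c: "c > 0" "\<And>x. norm x \<le> c * pnorm B x" using norm_le_pnorm[OF B] by blast
  have prod: "prod_list (map norm hs) \<le> c ^ length hs" if "\<forall>h\<in>set hs. pnorm B h \<le> 1" for hs
    using that
  proof (induction hs)
    case (Cons h hs)
    have "norm h \<le> c * 1" using c(2)[of h] Cons.prems c(1)
      by (meson list.set_intros(1) mult_left_mono order_trans less_imp_le)
    moreover have "0 \<le> prod_list (map norm hs)" by (induction hs) auto
    ultimately show ?case using Cons c(1) by (auto intro!: mult_mono)
  qed simp
  have bdd: "bdd_above ?S"
  proof (rule bdd_aboveI)
    fix y assume "y \<in> ?S"
    then obtain hs where "y = \<bar>A hs\<bar>" "length hs = n" "\<forall>h\<in>set hs. pnorm B h \<le> 1" by blast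
    then show "y \<le> K * c ^ n" using K(2)[of hs] mult_left_mono[OF prod[of hs] K(1)] by simp
  qed
  let ?g = "\<lambda>h. (1 / pnorm B h) *\<^sub>R h"
  have unit: "pnorm B (?g h) \<le> 1" for h
    by (cases "h = 0") (auto simp: pnorm_scaleR[OF B] pnorm_nonneg[OF B])
  have recover: "pnorm B h *\<^sub>R ?g h = h" for h
    using pnorm_pos[OF B, of h] by (cases "h = 0") auto
  have "A hs = A (map (\<lambda>h. pnorm B h *\<^sub>R ?g h) hs)" by (simp only: recover map_ident)
  also have "\<dots> = prod_list (map (pnorm B) hs) * A (map ?g hs)"
    using A hs by (intro multilinear_form_scale) simp
  finally have eq: "\<bar>A hs\<bar> = prod_list (map (pnorm B) hs) * \<bar>A (map ?g hs)\<bar>"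
    and nonneg: "0 \<le> prod_list (map (pnorm B) hs)"
  proof -
    show nn: "0 \<le> prod_list (map (pnorm B) hs)"
      by (induction hs) (auto simp: B)
    assume "A hs = prod_list (map (pnorm B) hs) * A (map ?g hs)"
    then show "\<bar>A hs\<bar> = prod_list (map (pnorm B) hs) * \<bar>A (map ?g hs)\<bar>"
      using nn by (simp add: abs_mult)
  qed
  have "\<bar>A (map ?g hs)\<bar> \<le> form_norm B n A"
    unfolding form_norm_def by (rule cSup_upper[OF _ bdd]) (use unit hs in \<open>auto intro!: exI[of _ "map ?g hs"]\<close>)
  from mult_right_mono[OF this nonneg] show ?thesis unfolding eq by (simp only: mult.commute)
qed

section \<open>Higher derivatives as forms\<close>

lemma Dform_has_derivative:
  assumes "times_differentiable p f" "length hs < p"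
  shows "(Dform f hs has_derivative (\<lambda>h. Dform f (h # hs) x)) (at x)"
proof -
  have "Dform f hs differentiable (at x)" using assms unfolding times_differentiable_def by blast
  then have "(Dform f hs has_derivative frechet_derivative (Dform f hs) (at x)) (at x)"
    by (rule frechet_derivative_works[THEN iffD1])
  then show ?thesis unfolding Dform.simps .
qed

text \<open>Linearity in the direction differentiated last is that of a Frechet derivative; in the other
  directions it passes from the differentiated functions to their derivatives.\<close>
lemma Dform_multilinear:
  assumes "times_differentiable p f" "n \<le> p"
  shows "multilinear_form n (\<lambda>hs. Dform f hs x)"
proof -
  have "linear (\<lambda>h. Dform f (as @ h # bs) x)" if "length as + length bs + 1 \<le> p" for as bs
    using that
  proof (induction as arbitrary: x)
    case Nil
    then have "length bs < p" by simp
    from has_derivative_linear[OF Dform_has_derivative[OF assms(1) this]]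
    show ?case by (simp only: append_Nil)
  next
    case (Cons a as)
    have lin: "linear (\<lambda>h. Dform f (as @ h # bs) y)" for y using Cons by simp
    have D: "(Dform f (as @ h # bs) has_derivative (\<lambda>a. Dform f (a # as @ h # bs) y)) (at y)" for h y
      using Cons.prems by (intro Dform_has_derivative[OF assms(1)]) simp
    show ?case
    proof (rule linearI)
      fix h k
      have "Dform f (as @ (h + k) # bs) = (\<lambda>y. Dform f (as @ h # bs) y + Dform f (as @ k # bs) y)"
        using linear_add[OF lin] by auto
      then have "(Dform f (as @ (h + k) # bs) has_derivative
          (\<lambda>a. Dform f (a # as @ h # bs) x + Dform f (a # as @ k # bs) x)) (at x)"
        using has_derivative_add[OF D D] by simp
      from fun_cong[OF has_derivative_unique[OF D this], of a]
      show "Dform f ((a # as) @ (h + k) # bs) x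
          = Dform f ((a # as) @ h # bs) x + Dform f ((a # as) @ k # bs) x"
        by (simp only: append_Cons)
    next
      fix r h
      have "Dform f (as @ (r *\<^sub>R h) # bs) = (\<lambda>y. r *\<^sub>R Dform f (as @ h # bs) y)"
        using linear_scale[OF lin] by auto
      then have "(Dform f (as @ (r *\<^sub>R h) # bs) has_derivative
          (\<lambda>a. r *\<^sub>R Dform f (a # as @ h # bs) x)) (at x)"
        using has_derivative_scaleR_right[OF D] by simp
      from fun_cong[OF has_derivative_unique[OF D this], of a]
      show "Dform f ((a # as) @ (r *\<^sub>R h) # bs) x = r *\<^sub>R Dform f ((a # as) @ h # bs) x"
        by (simp only: append_Cons)
    qed
  qed
  then show ?thesis using assms(2) unfolding multilinear_form_def by auto
qed

lemma Dform_symmetric: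
  assumes "times_differentiable p f" "n \<le> p"
  shows "symmetric_form n (\<lambda>hs. Dform f hs x)"
proof -
  have "Dform f (as @ h # k # bs) x = Dform f (as @ k # h # bs) x"
    if "length as + length bs + 2 \<le> p" for as bs h k
    using that
  proof (induction as arbitrary: x)
    case Nil
    have "Dform f bs differentiable (at y)" for y
      using Nil assms(1) unfolding times_differentiable_def by simp
    moreover have "(\<lambda>y. frechet_derivative (Dform f bs) (at y) h) differentiable (at x)" for h
      using Nil assms(1)[unfolded times_differentiable_def, rule_format, of "h # bs"] by simp
    ultimately show ?case using second_derivative_symmetric[of "Dform f bs" x k h] by simp
  next
    case (Cons a as)
    then have "Dform f (as @ h # k # bs) = Dform f (as @ k # h # bs)" by auto
    then show ?case by simp
  qed
  then show ?thesis using assms(2) unfolding symmetric_form_def by auto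
qed

lemma Dform_holder:
  assumes B: "self_adjoint_pos_def B" and f: "times_differentiable p f"
    and holder: "holder_const B f p \<nu> < \<infinity>" and hs: "length hs = p"
  shows "\<bar>Dform f hs x - Dform f hs y\<bar>
       \<le> enn2real (holder_const B f p \<nu>) * pnorm B (x - y) powr \<nu> * prod_list (map (pnorm B) hs)"
proof (cases "x = y")
  case False
  let ?A = "\<lambda>hs. Dform f hs x - Dform f hs y"
  have pos: "pnorm B (x - y) powr \<nu> > 0" using pnorm_pos[OF B, of "x - y"] False by simp
  have "ennreal (form_norm B p ?A / pnorm B (x - y) powr \<nu>) \<le> holder_const B f p \<nu>"
    unfolding holder_const_def using False by (intro SUP_upper2[of "(x, y)"]) simp_all
  then have "form_norm B p ?A / pnorm B (x - y) powr \<nu> \<le> enn2real (holder_const B f p \<nu>)"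
  proof -
    have "a \<le> enn2real (ennreal a)" for a by (cases "0 \<le> a") (auto simp: ennreal_neg)
    then show ?thesis
      using holder enn2real_mono \<open>ennreal _ \<le> _\<close> order_trans unfolding infinity_ennreal_def by blast
  qed
  then have "form_norm B p ?A \<le> enn2real (holder_const B f p \<nu>) * pnorm B (x - y) powr \<nu>"
    using pos by (simp add: field_simps)
  moreover have "0 \<le> prod_list (map (pnorm B) hs)" by (induction hs) (auto simp: B)
  moreover have "multilinear_form p ?A"
    by (intro multilinear_form_diff Dform_multilinear[OF f]) auto
  ultimately show ?thesis
    using form_norm_bound[OF B _ hs, of ?A] mult_right_mono by (meson order_trans)
qed simp

section \<open>Taylor bounds\<close>

lemma Dform_taylor_lagrange:
  assumes f: "times_differentiable p f" and n: "0 < n" "n + length hs \<le> p"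
  shows "\<exists>t. 0 < t \<and> t < 1 \<and>
      Dform f hs (x + h) = (\<Sum>j<n. Dform f (replicate j h @ hs) x / fact j)
                         + Dform f (replicate n h @ hs) (x + t *\<^sub>R h) / fact n"
proof -
  define \<phi> where "\<phi> = (\<lambda>j t. Dform f (replicate j h @ hs) (x + t *\<^sub>R h))"
  have deriv: "(\<phi> j has_real_derivative \<phi> (Suc j) t) (at t)" if "j < n" for j t
  proof -
    let ?L = "replicate j h @ hs"
    have len: "length ?L < p" using that n by simp
    have D: "(Dform f ?L has_derivative (\<lambda>v. Dform f (v # ?L) (x + t *\<^sub>R h))) (at (x + t *\<^sub>R h))"
      by (rule Dform_has_derivative[OF f len])
    have "((\<lambda>t. x + t *\<^sub>R h) has_derivative (\<lambda>u. u *\<^sub>R h)) (at t)"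
      by (auto intro!: derivative_eq_intros)
    from has_derivative_compose[OF this D]
    have "(\<phi> j has_derivative (\<lambda>u. Dform f ((u *\<^sub>R h) # ?L) (x + t *\<^sub>R h))) (at t)"
      unfolding \<phi>_def .
    moreover have "Dform f ((u *\<^sub>R h) # ?L) (x + t *\<^sub>R h) = \<phi> (Suc j) t * u" for u
      using linear_scale[OF has_derivative_linear[OF D], of u h] by (simp add: \<phi>_def)
    ultimately show ?thesis unfolding has_field_derivative_def by simp
  qed
  have "\<exists>t::real. 0 < t \<and> t < 1 \<and>
      \<phi> 0 1 = (\<Sum>j<n. (\<phi> j 0 / fact j) * 1 ^ j) + (\<phi> n t / fact n) * 1 ^ n"
    by (rule Maclaurin) (use n deriv in auto)
  then show ?thesis by (simp add: \<phi>_def)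
qed

text \<open>The Lagrange remainder differs from the last Taylor term only in the base point of the top
  derivative, and the Hoelder condition compares the two. The Lagrange form is the right one here
  because the top derivative may be too irregular for the integral form of the remainder. The list
  \<open>hs\<close> is empty for the bound on \<open>f\<close> and a single direction for the bound on its gradient.\<close>
lemma Dform_taylor_remainder:
  fixes f :: "'a::euclidean_space \<Rightarrow> real"
  assumes B: "self_adjoint_pos_def B" and f: "times_differentiable p f"
    and holder: "holder_const B f p \<nu> < \<infinity>" and nu: "0 \<le> \<nu>"
    and n: "0 < n" "n + length hs = p"
  shows "\<bar>Dform f hs (x + h) - (\<Sum>j\<le>n. Dform f (replicate j h @ hs) x / fact j)\<bar>
       \<le> enn2real (holder_const B f p \<nu>) / fact n * pnorm B h powr (real n + \<nu>)
           * prod_list (map (pnorm B) hs)"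
proof -
  let ?L = "enn2real (holder_const B f p \<nu>)"
  let ?hs = "replicate n h @ hs"
  obtain t where t: "0 < t" "t < 1" and eq:
    "Dform f hs (x + h) = (\<Sum>j<n. Dform f (replicate j h @ hs) x / fact j)
                         + Dform f ?hs (x + t *\<^sub>R h) / fact n"
    using Dform_taylor_lagrange[OF f n(1), of hs x h] n(2) by auto
  have prod: "prod_list (map (pnorm B) ?hs) = pnorm B h ^ n * prod_list (map (pnorm B) hs)"
    by (simp add: map_replicate_const prod_list.append)
  have prod_nonneg: "0 \<le> prod_list (map (pnorm B) ?hs)"
    by (rule prod_list_nonneg) (use B in auto)
  have "{..n} = insert n {..<n}" by auto
  then have "Dform f hs (x + h) - (\<Sum>j\<le>n. Dform f (replicate j h @ hs) x / fact j)
      = (Dform f ?hs (x + t *\<^sub>R h) - Dform f ?hs x) / fact n"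
    unfolding eq by (simp add: diff_divide_distrib)
  also have "\<bar>\<dots>\<bar> = \<bar>Dform f ?hs (x + t *\<^sub>R h) - Dform f ?hs x\<bar> / fact n" by simp
  also have "\<dots> \<le> ?L * pnorm B (x + t *\<^sub>R h - x) powr \<nu> * prod_list (map (pnorm B) ?hs) / fact n"
    using Dform_holder[OF B f holder, of ?hs "x + t *\<^sub>R h" x] n by (intro divide_right_mono) auto
  also have "\<dots> \<le> ?L * pnorm B h powr \<nu> * prod_list (map (pnorm B) ?hs) / fact n"
  proof -
    have "pnorm B (x + t *\<^sub>R h - x) \<le> pnorm B h"
      using t B by (simp add: pnorm_scaleR mult_left_le_one_le)
    then show ?thesis
      using prod_nonneg nu B
      by (intro divide_right_mono mult_right_mono mult_left_mono powr_mono2) auto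
  qed
  also have "\<dots> = ?L / fact n * pnorm B h powr (real n + \<nu>) * prod_list (map (pnorm B) hs)"
  proof (cases "h = 0")
    case False
    then have "pnorm B h > 0" by (rule pnorm_pos[OF B])
    then show ?thesis unfolding prod by (simp add: powr_add powr_realpow)
  next
    case True
    then show ?thesis unfolding prod using n(1) by simp
  qed
  finally show ?thesis .
qed

lemma grad_apply:
  assumes "(f has_derivative D) (at x)"
  shows "blinfun_apply (grad f x) = D"
  using assms frechet_derivative_at[OF assms] has_derivative_bounded_linear[OF assms]
  unfolding grad_def by (simp add: bounded_linear_Blinfun_apply)

lemma grad_eq_Dform:
  assumes "times_differentiable p f" "0 < p"
  shows "blinfun_apply (grad f x) v = Dform f [v] x"
  using grad_apply[OF Dform_has_derivative[OF assms(1), of "[]"]] assms(2) by simp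

lemma taylor_poly_eq: "taylor_poly f p x y = (\<Sum>j\<le>p. Dform f (replicate j (y - x)) x / fact j)"
proof -
  have "{..p} = insert 0 {1..p}" by auto
  then show ?thesis by (simp add: taylor_poly_def)
qed

lemma taylor_poly_error:
  assumes "self_adjoint_pos_def B" "times_differentiable p f"
    and "holder_const B f p \<nu> < \<infinity>" "0 \<le> \<nu>" "0 < p"
  shows "\<bar>f y - taylor_poly f p x y\<bar>
       \<le> enn2real (holder_const B f p \<nu>) / fact p * pnorm B (y - x) powr (real p + \<nu>)"
  using Dform_taylor_remainder[OF assms, of "[]" x "y - x"] by (simp add: taylor_poly_eq)

lemma taylor_poly_has_derivative:
  assumes f: "times_differentiable p f"
  shows "(taylor_poly f p x has_derivative
      (\<lambda>v. \<Sum>j<p. Dform f (replicate j (y - x) @ [v]) x / fact j)) (at y)"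
proof -
  have "((\<lambda>y. \<Sum>j\<le>p. Dform f (replicate j (y - x)) x / fact j) has_derivative
      (\<lambda>v. \<Sum>j\<le>p. real j * Dform f (replicate (j - 1) (y - x) @ [v]) x / fact j)) (at y)"
  proof (intro has_derivative_sum)
    fix j assume "j \<in> {..p}"
    then have "((\<lambda>h. Dform f (replicate j h) x) has_derivative
        (\<lambda>v. real j * Dform f (replicate (j - 1) (y - x) @ [v]) x)) (at (y - x))"
      by (intro has_derivative_diagonal Dform_multilinear[OF f] Dform_symmetric[OF f]) auto
    moreover have "((\<lambda>y. y - x) has_derivative (\<lambda>v. v)) (at y)"
      by (auto intro!: derivative_eq_intros)
    ultimately have "((\<lambda>y. Dform f (replicate j (y - x)) x) has_derivative
        (\<lambda>v. real j * Dform f (replicate (j - 1) (y - x) @ [v]) x)) (at y)"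
      using has_derivative_compose[of "\<lambda>y. y - x" "\<lambda>v. v" y UNIV "\<lambda>h. Dform f (replicate j h) x"] by blast
    then show "((\<lambda>y. Dform f (replicate j (y - x)) x / fact j) has_derivative
        (\<lambda>v. real j * Dform f (replicate (j - 1) (y - x) @ [v]) x / fact j)) (at y)"
      by (rule bounded_linear.has_derivative[OF bounded_linear_divide])
  qed
  moreover have "(\<Sum>j\<le>p. real j * Dform f (replicate (j - 1) (y - x) @ [v]) x / fact j)
      = (\<Sum>j<p. Dform f (replicate j (y - x) @ [v]) x / fact j)" for v
  proof -
    have "(\<Sum>j\<le>p. real j * Dform f (replicate (j - 1) (y - x) @ [v]) x / fact j)
        = (\<Sum>j<p. real (Suc j) * Dform f (replicate j (y - x) @ [v]) x / fact (Suc j))"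
      by (simp only: sum.atMost_shift) simp
    also have "\<dots> = (\<Sum>j<p. Dform f (replicate j (y - x) @ [v]) x / fact j)"
      by (intro sum.cong refl) (simp add: fact_Suc del: of_nat_Suc)
    finally show ?thesis .
  qed
  ultimately show ?thesis unfolding taylor_poly_eq by simp
qed

text \<open>Symmetry of the derivatives makes the gradient of the Taylor polynomial of \<open>f\<close> the Taylor
  polynomial, of one degree less, of \<open>y \<mapsto> Df(y)[v]\<close>.\<close>
lemma taylor_poly_grad_error:
  assumes B: "self_adjoint_pos_def B" and f: "times_differentiable p f"
    and holder: "holder_const B f p \<nu> < \<infinity>" and nu: "0 \<le> \<nu>" and p: "2 \<le> p"
  shows "\<bar>blinfun_apply (grad f y) v - (\<Sum>j<p. Dform f (replicate j (y - x) @ [v]) x / fact j)\<bar>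
       \<le> enn2real (holder_const B f p \<nu>) / fact (p - 1) * pnorm B (y - x) powr (real p + \<nu> - 1)
           * pnorm B v"
proof -
  have "{..p - 1} = {..<p}" using p by auto
  then show ?thesis
    using Dform_taylor_remainder[OF B f holder nu, of "p - 1" "[v]" x "y - x"] p
    by (simp add: grad_eq_Dform[OF f] of_nat_diff algebra_simps)
qed

section \<open>The regularization term\<close>

text \<open>At \<open>h = 0\<close> the power of the quadratic form cannot be differentiated by the chain rule; there the
  derivative vanishes because \<open>\<parallel>h\<parallel>\<^sup>e = O(|h|\<^sup>2)\<close>.\<close>
lemma pnorm_powr_has_derivative:
  fixes B :: "'a::euclidean_space \<Rightarrow> 'a \<Rightarrow>\<^sub>L real"
  assumes B: "self_adjoint_pos_def B" and e: "2 \<le> e"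
  shows "((\<lambda>h. pnorm B h powr e) has_derivative
           (\<lambda>v. e * pnorm B h powr (e - 2) * blinfun_apply (B h) v)) (at h)"
proof (cases "h = 0")
  case False
  define Q where "Q = (\<lambda>h. blinfun_apply (B h) h)"
  have Qpos: "Q h > 0" using B False unfolding Q_def self_adjoint_pos_def_def by blast
  have pQ: "pnorm B h powr c = Q h powr (c / 2)" for c h
    unfolding pnorm_def Q_def using dual_pairing_nonneg[OF B, of h]
    by (simp add: powr_half_sqrt[symmetric] powr_powr)
  have "(B has_derivative B) (at h)"
    by (rule bounded_linear_imp_has_derivative[OF bounded_linear_B[OF B]])
  then have "(Q has_derivative (\<lambda>v. blinfun_apply (B h) v + blinfun_apply (B v) h)) (at h)"
    unfolding Q_def by (rule blinfun.FDERIV) (rule has_derivative_ident)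
  then have Q': "(Q has_derivative (\<lambda>v. 2 * blinfun_apply (B h) v)) (at h)"
    using dual_pairing_sym[OF B, of _ h] by simp
  have "((\<lambda>z. z powr (e / 2)) has_derivative (*) ((e / 2) * Q h powr (e / 2 - 1))) (at (Q h))"
    using has_real_derivative_powr[OF Qpos, of "e / 2"] by (simp add: has_field_derivative_def)
  from has_derivative_compose[OF Q' this]
  show ?thesis by (simp add: pQ diff_divide_distrib mult.assoc mult.left_commute)
next
  case True
  obtain c where c: "c > 0" "\<And>x. pnorm B x \<le> c * norm x" using pnorm_le_norm[OF B] by blast
  have "\<exists>d>0. \<forall>y. norm (y - h) < d \<longrightarrow> 
     norm (pnorm B y powr e - pnorm B h powr e - 0) \<le> E * norm (y - h)" if E: "E > 0" for E
  proof (intro exI conjI allI impI)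
    show "min 1 (E / c powr e) > 0" using E c by simp
    fix y :: 'a assume "norm (y - h) < min 1 (E / c powr e)"
    then have y: "norm y \<le> 1" "norm y * c powr e \<le> E" 
      using c by (auto simp: True field_simps)
    have "pnorm B y powr e \<le> (c * norm y) powr e"
      using c e B by (intro powr_mono2) auto
    also have "\<dots> = c powr e * norm y powr e" using c by (simp add: powr_mult)
    also have "\<dots> \<le> c powr e * norm y powr 2"
      using y e by (intro mult_left_mono powr_mono') auto
    also have "\<dots> = norm y * c powr e * norm y" by (simp add: power2_eq_square)
    also have "\<dots> \<le> E * norm y" using y(2) by (rule mult_right_mono) simp
    finally show "norm (pnorm B y powr e - pnorm B h powr e - 0) \<le> E * norm (y - h)"
      by (simp add: True)
  qed
  then show ?thesis using True linear_0[OF linear_B[OF B]] 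
    unfolding has_derivative_at_alt by simp
qed

lemma reg_model_has_derivative:
  fixes B :: "'a::euclidean_space \<Rightarrow> 'a \<Rightarrow>\<^sub>L real"
  assumes B: "self_adjoint_pos_def B" and f: "times_differentiable p f"
    and p: "2 \<le> real p + \<alpha>"
  shows "(reg_model B f \<alpha> p H x has_derivative
      (\<lambda>v. (\<Sum>j<p. Dform f (replicate j (y - x) @ [v]) x / fact j)
         + H / fact p * ((real p + \<alpha>) * pnorm B (y - x) powr (real p + \<alpha> - 2)
                          * blinfun_apply (B (y - x)) v))) (at y)"
proof -
  have "((\<lambda>y. y - x) has_derivative (\<lambda>v. v)) (at y)"
    by (auto intro!: derivative_eq_intros)
  from has_derivative_compose[OF this pnorm_powr_has_derivative[OF B p]]
  have "((\<lambda>y. H / fact p * pnorm B (y - x) powr (real p + \<alpha>)) has_derivative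
      (\<lambda>v. H / fact p * ((real p + \<alpha>) * pnorm B (y - x) powr (real p + \<alpha> - 2)
                          * blinfun_apply (B (y - x)) v))) (at y)"
    by (rule has_derivative_mult_right)
  from has_derivative_add[OF taylor_poly_has_derivative[OF f, of x y] this]
  show ?thesis unfolding reg_model_def .
qed

section \<open>Trial points\<close>

text \<open>Three errors add up: that of the Taylor model of the gradient, the gradient of the
  regularization term, and the residual allowed for an approximate solution.\<close>
lemma trial_point_gradient:
  fixes B :: "'a::euclidean_space \<Rightarrow> 'a \<Rightarrow>\<^sub>L real"
  assumes B: "self_adjoint_pos_def B" and f: "times_differentiable p f"
    and holder: "holder_const B f p \<nu> < \<infinity>" and nu: "0 \<le> \<nu>" and p: "2 \<le> p"
    and alpha: "0 \<le> \<alpha>" and H: "0 \<le> H" and theta: "0 \<le> \<theta>"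
    and sol: "approx_solution B f \<alpha> p \<theta> H x y"
  shows "dnorm B (grad f y)
      \<le> enn2real (holder_const B f p \<nu>) / fact (p - 1) * pnorm B (y - x) powr (real p + \<nu> - 1)
        + (H * (real p + \<alpha>) / fact p + \<theta>) * pnorm B (y - x) powr (real p + \<alpha> - 1)"
    (is "_ \<le> ?e + (?c + \<theta>) * ?r")
proof (rule dnorm_leI[OF B])
  show "0 \<le> ?e + (?c + \<theta>) * ?r" using H theta alpha by simp
  fix v
  let ?S = "\<Sum>j<p. Dform f (replicate j (y - x) @ [v]) x / fact j"
  let ?b = "blinfun_apply (B (y - x)) v"
  let ?m = "blinfun_apply (grad (reg_model B f \<alpha> p H x) y) v"
  let ?k = "H / fact p * ((real p + \<alpha>) * pnorm B (y - x) powr (real p + \<alpha> - 2) * ?b)"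
  have m: "?m = ?S + ?k"
    using fun_cong[OF grad_apply[OF reg_model_has_derivative[OF B f, of \<alpha> H x y]], of v] p alpha
    by simp
  have "?m \<le> dnorm B (grad (reg_model B f \<alpha> p H x) y) * pnorm B v"
    using abs_apply_le_dnorm[OF B] abs_le_D1 by blast
  also have "\<dots> \<le> (\<theta> * ?r) * pnorm B v"
    using sol B unfolding approx_solution_def by (intro mult_right_mono) auto
  finally have m_le: "?m \<le> \<theta> * ?r * pnorm B v" .
  have "- ?k \<le> H / fact p * ((real p + \<alpha>) * pnorm B (y - x) powr (real p + \<alpha> - 2) * \<bar>?b\<bar>)"
    using H alpha by (simp only: mult_minus_right[symmetric]) (intro mult_left_mono; simp)
  also have "\<dots> \<le> H / fact p * ((real p + \<alpha>) * pnorm B (y - x) powr (real p + \<alpha> - 2)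
        * (pnorm B (y - x) * pnorm B v))"
    using H alpha dual_pairing_Cauchy_Schwarz[OF B, of "y - x" v]
    by (intro mult_left_mono) auto
  also have "\<dots> = ?c * (pnorm B (y - x) powr (real p + \<alpha> - 2) * pnorm B (y - x)) * pnorm B v"
    by simp
  also have "pnorm B (y - x) powr (real p + \<alpha> - 2) * pnorm B (y - x) = ?r"
    using powr_mult_base[OF pnorm_nonneg[OF B], of "y - x" "real p + \<alpha> - 2"] by (simp add: mult.commute add.commute)
  finally have k_le: "- ?k \<le> ?c * ?r * pnorm B v" .
  have "blinfun_apply (grad f y) v - ?S \<le> ?e * pnorm B v"
    using taylor_poly_grad_error[OF B f holder nu p, of y v x] by simp
  then show "blinfun_apply (grad f y) v \<le> (?e + (?c + \<theta>) * ?r) * pnorm B v"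
    using m m_le k_le by (simp add: algebra_simps)
qed

text \<open>The regularized model lies below \<open>f x\<close> at the trial point, so \<open>f\<close> decreases by the
  regularization term, up to the Taylor error.\<close>
lemma trial_point_decrease:
  fixes B :: "'a::euclidean_space \<Rightarrow> 'a \<Rightarrow>\<^sub>L real"
  assumes B: "self_adjoint_pos_def B" and f: "times_differentiable p f"
    and holder: "holder_const B f p \<nu> < \<infinity>" and nu: "0 \<le> \<nu>" and p: "0 < p"
    and sol: "approx_solution B f \<alpha> p \<theta> H x y"
  shows "H / fact p * pnorm B (y - x) powr (real p + \<alpha>)
       - enn2real (holder_const B f p \<nu>) / fact p * pnorm B (y - x) powr (real p + \<nu>)
       \<le> f x - f y"
  using taylor_poly_error[OF B f holder nu p, of y x] sol
  unfolding approx_solution_def reg_model_def by linarith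

section \<open>Acceptance of trial points\<close>

text \<open>Write \<open>k = \<beta> / \<omega>\<close>. The bound on \<open>\<epsilon>\<close> says that \<open>1 \<le> 4ar\<^sup>\<omega> / \<epsilon>\<close>; the \<open>k\<close>-th power of this, multiplied
  by \<open>a\<close>, is exactly the lower bound for \<open>H\<close> times \<open>r\<^sup>\<beta>\<close>. For \<open>\<beta> = 1 - \<nu>\<close> and \<open>\<omega> = p + \<nu> - 1\<close> that lower
  bound is the second term of \<open>N\<^sub>\<nu>(\<epsilon>)\<close> in the case of unknown \<open>\<nu>\<close>, which explains its form.\<close>
lemma large_regularization_dominates:
  fixes a r \<epsilon> \<omega> \<beta> H :: real
  assumes pos: "0 < a" "0 < r" "0 < \<epsilon>" "0 < \<omega>" "0 \<le> \<beta>"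
    and H: "a powr ((\<omega> + \<beta>) / \<omega>) * 4 powr (\<beta> / \<omega>) * \<epsilon> powr (- (\<beta> / \<omega>)) \<le> H"
    and eps: "\<epsilon> \<le> 4 * a * r powr \<omega>"
  shows "a \<le> H * r powr \<beta>"
proof -
  define k where "k = \<beta> / \<omega>"
  have k: "0 \<le> k" using pos by (simp add: k_def)
  have e1: "(\<omega> + \<beta>) / \<omega> = 1 + k" using pos by (simp add: k_def field_simps)
  have "1 \<le> (4 * a * r powr \<omega> / \<epsilon>) powr k"
    using eps pos k by (intro ge_one_powr_ge_zero) (auto simp: field_simps)
  also have "\<dots> = 4 powr k * a powr k * \<epsilon> powr (- k) * r powr \<beta>"
    using pos by (simp add: k_def powr_divide powr_mult powr_powr powr_minus field_simps)
  finally have "a * 1 \<le> a * (4 powr k * a powr k * \<epsilon> powr (- k) * r powr \<beta>)"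
    using pos(1) by (intro mult_left_mono) auto
  also have "\<dots> = a powr (1 + k) * 4 powr k * \<epsilon> powr (- k) * r powr \<beta>"
    using pos(1) by (simp add: powr_add)
  also have "\<dots> \<le> H * r powr \<beta>"
    using H unfolding e1 k_def[symmetric] by (intro mult_right_mono) auto
  finally show ?thesis by simp
qed

text \<open>Both bounds are powers of the step length \<open>r\<close>; eliminating \<open>r\<close> compares the decrease of \<open>f\<close> with
  the gradient. The factor \<open>8\<close> lost in \<open>X\<close> is the one in the acceptance test, and \<open>3 \<le> p + 1\<close>.\<close>
lemma functional_decrease_from_step:
  fixes p :: nat and q H X r g \<Delta> :: real
  assumes p: "2 \<le> p" and q: "1 \<le> q" and pos: "0 < H" "0 \<le> X" "0 \<le> r" "0 \<le> g"
    and X: "X powr ((q + 1) / q) \<le> 8"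
    and \<Delta>: "H / (3 * fact p) * r powr (q + 1) \<le> \<Delta>"
    and g: "g \<le> H * X * r powr q"
  shows "1 / (8 * fact (p + 1) * H powr (1 / q)) * g powr ((q + 1) / q) \<le> \<Delta>"
proof -
  have "g powr ((q + 1) / q) \<le> (H * X * r powr q) powr ((q + 1) / q)"
    using g pos q by (intro powr_mono2) auto
  also have "\<dots> = H powr ((q + 1) / q) * X powr ((q + 1) / q) * r powr (q + 1)"
    using pos q by (simp add: powr_mult powr_powr)
  also have "\<dots> \<le> H powr ((q + 1) / q) * 8 * r powr (q + 1)"
    using X by (intro mult_right_mono mult_left_mono) auto
  also have "H powr ((q + 1) / q) = H * H powr (1 / q)"
  proof -
    have "(q + 1) / q = 1 + 1 / q" using q by (simp add: field_simps)
    then show ?thesis using pos by (simp add: powr_add)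
  qed
  finally have "g powr ((q + 1) / q) \<le> 8 * H powr (1 / q) * (H * r powr (q + 1))"
    by (simp add: ac_simps)
  then have "1 / (8 * fact (p + 1) * H powr (1 / q)) * g powr ((q + 1) / q)
      \<le> 1 / (8 * fact (p + 1) * H powr (1 / q)) * (8 * H powr (1 / q) * (H * r powr (q + 1)))"
    by (intro mult_left_mono) auto
  also have "\<dots> = H * r powr (q + 1) / fact (p + 1)"
    using pos by (simp add: field_simps del: fact_Suc)
  also have "\<dots> \<le> H * r powr (q + 1) / (3 * fact p)"
    using p pos by (intro divide_left_mono) (auto intro!: mult_right_mono)
  also have "\<dots> \<le> \<Delta>" using \<Delta> by simp
  finally show ?thesis .
qed

lemma fact_real_bounds:
  fixes p :: nat
  assumes "2 \<le> p"
  shows "real p \<le> fact p" "(2::real) \<le> fact p"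
proof -
  have "p \<le> fact p" by (rule fact_ge_self)
  then show "real p \<le> fact p" by (metis of_nat_fact of_nat_le_iff)
  then show "(2::real) \<le> fact p" using assms by linarith
qed

lemma fact_pred_real:
  fixes p :: nat
  assumes "0 < p"
  shows "1 / fact (p - 1) = real p / (fact p :: real)"
  using assms by (cases p) (simp_all add: fact_Suc del: of_nat_Suc)

text \<open>For known \<open>\<nu>\<close> this is part of the definition of \<open>N\<^sub>\<nu>(\<epsilon>)\<close>. For unknown \<open>\<nu>\<close> the powers
  \<open>r\<^sup>p\<^sup>+\<^sup>\<nu>\<close> and \<open>r\<^sup>p\<^sup>+\<^sup>1\<close> of the step length \<open>r\<close> differ when \<open>\<nu> < 1\<close>, and very short steps would spoil the
  comparison. But if it fails, then the Hoelder term dominates the bound on the gradient at the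
  trial point; this gradient exceeds \<open>\<epsilon>\<close>, so the step is too long for the comparison to fail.\<close>
lemma regularization_beats_holder_remainder:
  fixes B :: "'a::euclidean_space \<Rightarrow> 'a \<Rightarrow>\<^sub>L real"
  assumes B: "self_adjoint_pos_def B" and f: "times_differentiable p f"
    and holder: "holder_const B f p \<nu> < \<infinity>" and nu: "0 \<le> \<nu>" "\<nu> \<le> 1" and p: "2 \<le> p"
    and alpha: "\<alpha> = alpha known \<nu>" and H: "0 < H" "N_const B f p \<nu> known \<theta> \<epsilon> \<le> H"
    and theta: "0 \<le> \<theta>" "\<theta> \<le> H" and eps: "0 < \<epsilon>"
    and sol: "approx_solution B f \<alpha> p \<theta> H x y"
    and g: "\<epsilon> < dnorm B (grad f y)" and r: "0 < pnorm B (y - x)"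
  shows "3 * enn2real (holder_const B f p \<nu>) / 2 \<le> H * pnorm B (y - x) powr (\<alpha> - \<nu>)"
proof (cases known)
  case True
  then show ?thesis using alpha H r by (simp add: alpha_def N_const_def Let_def)
next
  case False
  define L where "L = enn2real (holder_const B f p \<nu>)"
  define r where "r = pnorm B (y - x)"
  define \<omega> where "\<omega> = real p + \<nu> - 1"
  have a: "\<alpha> = 1" using False alpha by (simp add: alpha_def)
  have L: "0 \<le> L" by (simp add: L_def)
  have \<omega>: "1 \<le> \<omega>" using p nu by (simp add: \<omega>_def)
  have rpos: "0 < r" using r by (simp add: r_def)
  show ?thesis
  proof (rule ccontr)
    assume "\<not> ?thesis"
    then have neg: "H * r powr (1 - \<nu>) < 3 * L / 2" by (simp add: L_def r_def a)
    have "0 < H * r powr (1 - \<nu>)" using H(1) rpos by simp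
    then have Lpos: "0 < L" using neg by linarith
    have Hr: "H * r powr real p \<le> 3 * L / 2 * r powr \<omega>"
    proof -
      have "H * r powr real p = H * r powr (1 - \<nu>) * r powr \<omega>"
        by (simp add: \<omega>_def powr_add[symmetric] mult.assoc)
      also have "\<dots> \<le> 3 * L / 2 * r powr \<omega>" using neg by (intro mult_right_mono) auto
      finally show ?thesis .
    qed
    have "dnorm B (grad f y) \<le> L / fact (p - 1) * r powr \<omega>
        + (H * (real p + 1) / fact p + \<theta>) * r powr real p"
      using trial_point_gradient[OF B f holder nu(1) p _ _ theta(1) sol] H
      by (simp add: a \<omega>_def L_def r_def)
    also have "\<dots> \<le> L * r powr \<omega> + (H * (3/2) + H) * r powr real p"
    proof (intro add_mono mult_right_mono)
      show "L / fact (p - 1) \<le> L" using L by (simp add: field_simps mult_le_cancel_left1)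
      have "(real p + 1) / fact p \<le> 3 / 2"
        using fact_real_bounds[OF p] by (simp add: field_simps)
      from mult_left_mono[OF this, of H] show "H * (real p + 1) / fact p \<le> H * (3/2)"
        using H by simp
    qed (use theta in auto)
    also have "\<dots> = L * r powr \<omega> + 5 / 2 * (H * r powr real p)" by (simp add: algebra_simps)
    also have "\<dots> \<le> L * r powr \<omega> + 5 / 2 * (3 * L / 2 * r powr \<omega>)"
      using Hr by (intro add_left_mono mult_left_mono) auto
    \<comment> \<open>The factor is \<open>1 + 15/4\<close>, and the constant \<open>4\<close> in \<open>N\<^sub>\<nu>(\<epsilon>)\<close> leaves room for \<open>4 * 3/2 = 6\<close>.\<close>
    also have "\<dots> \<le> 4 * (3 * L / 2) * r powr \<omega>" using L by (simp add: algebra_simps)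
    finally have eps_le: "\<epsilon> \<le> 4 * (3 * L / 2) * r powr \<omega>" using g by linarith
    have H_ge: "(3 * L / 2) powr ((\<omega> + (1 - \<nu>)) / \<omega>) * 4 powr ((1 - \<nu>) / \<omega>)
        * \<epsilon> powr (- ((1 - \<nu>) / \<omega>)) \<le> H"
    proof -
      have "(3 * L / 2) powr ((\<omega> + (1 - \<nu>)) / \<omega>) * 4 powr ((1 - \<nu>) / \<omega>)
        * \<epsilon> powr (- ((1 - \<nu>) / \<omega>)) \<le> N_const B f p \<nu> known \<theta> \<epsilon>"
        using False by (simp add: N_const_def Let_def L_def \<omega>_def mult_right_mono)
      then show ?thesis using H by linarith
    qed
    have "3 * L / 2 \<le> H * r powr (1 - \<nu>)"
      by (rule large_regularization_dominates[OF _ rpos eps _ _ H_ge eps_le])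
        (use Lpos \<omega> nu in simp_all)
    then show False using neg by simp
  qed
qed

lemma N_const_ge_theta:
  assumes "0 \<le> \<theta>" "0 < \<epsilon>" "\<epsilon> < 1" "0 \<le> \<nu>" "\<nu> \<le> 1" "2 \<le> p"
  shows "\<theta> \<le> N_const B f p \<nu> known \<theta> \<epsilon>"
proof (cases known)
  case True
  have "\<theta> * 1 \<le> \<theta> * (3 * fact (p - 1))"
  proof (rule mult_left_mono)
    show "1 \<le> (3 * fact (p - 1) :: real)"
      using fact_ge_1[of "p - 1", where 'a = real] by linarith
  qed (use assms in simp)
  then show ?thesis using True by (simp add: N_const_def Let_def mult.assoc mult.left_commute)
next
  case False
  let ?k = "(1 - \<nu>) / (real p + \<nu> - 1)"
  let ?m = "max \<theta> ((3 * enn2real (holder_const B f p \<nu>) / 2) powr (real p / (real p + \<nu> - 1))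
                   * 4 powr ?k)"
  have "1 \<le> \<epsilon> powr (- ?k)"
  proof -
    have "0 \<le> ?k" using assms by simp
    then have "\<epsilon> powr ?k \<le> 1" using assms by (intro powr_le1) auto
    then show ?thesis using assms by (simp add: powr_minus one_le_inverse)
  qed
  then have "?m * 1 \<le> ?m * \<epsilon> powr (- ?k)" using assms(1) by (intro mult_left_mono) auto
  then show ?thesis using False by (simp add: N_const_def Let_def)
qed

text \<open>Once the Hoelder terms are at most two thirds of the corresponding powers of the
  regularization, one third of it is left for the decrease of \<open>f\<close>, while the gradient is at most
  \<open>H X r\<^sup>q\<close> with a numerical factor \<open>X\<close>. That \<open>X\<close> is small enough uses only \<open>p \<le> p!\<close> and \<open>2 \<le> p!\<close>.\<close>
lemma trial_point_accepted:
  fixes B :: "'a::euclidean_space \<Rightarrow> 'a \<Rightarrow>\<^sub>L real"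
  assumes B: "self_adjoint_pos_def B" and f: "times_differentiable p f"
    and holder: "holder_const B f p \<nu> < \<infinity>" and nu: "0 \<le> \<nu>" "\<nu> \<le> 1" and p: "2 \<le> p"
    and alpha: "\<alpha> = alpha known \<nu>" and H: "0 < H" "N_const B f p \<nu> known \<theta> \<epsilon> \<le> H"
    and theta: "0 \<le> \<theta>" and eps: "0 < \<epsilon>" "\<epsilon> < 1"
    and sol: "approx_solution B f \<alpha> p \<theta> H x y"
  shows "accepted B f \<alpha> p \<epsilon> H x y"
proof (cases "dnorm B (grad f y) \<le> \<epsilon>")
  case True
  then show ?thesis by (simp add: accepted_def)
next
  case False
  define L where "L = enn2real (holder_const B f p \<nu>)"
  define r where "r = pnorm B (y - x)"
  define g where "g = dnorm B (grad f y)"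
  define q where "q = real p + \<alpha> - 1"
  have a01: "0 \<le> \<alpha>" "\<alpha> \<le> 1" using alpha nu by (auto simp: alpha_def)
  have q: "1 \<le> q" using p a01 by (simp add: q_def)
  have theta_H: "\<theta> \<le> H" using N_const_ge_theta[OF theta eps nu p, of B f known] H(2) by linarith
  have geps: "\<epsilon> < g" using False by (simp add: g_def)
  have grad_le: "g \<le> L / fact (p - 1) * r powr (real p + \<nu> - 1)
        + (H * (real p + \<alpha>) / fact p + \<theta>) * r powr q"
    using trial_point_gradient[OF B f holder nu(1) p a01(1) _ theta sol] H(1)
    by (simp add: g_def r_def L_def q_def)
  \<comment> \<open>A step of length zero would leave the gradient bound \<open>0\<close>, as \<open>0 powr c = 0\<close>.\<close>
  have "r \<noteq> 0"
  proof
    assume "r = 0"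
    then show False using grad_le geps eps by simp
  qed
  then have r: "0 < r" using pnorm_nonneg[OF B, of "y - x"] by (simp add: r_def)
  have "3 * L / 2 \<le> H * r powr (\<alpha> - \<nu>)"
    using regularization_beats_holder_remainder[OF B f holder nu p alpha H theta theta_H eps(1) sol]
      geps r by (simp add: g_def r_def L_def)
  then have "L \<le> 2 / 3 * H * r powr (\<alpha> - \<nu>)" by simp
  then have Lr: "L * r powr c \<le> 2 / 3 * H * r powr (c + (\<alpha> - \<nu>))" for c
    using mult_right_mono[of L "2 / 3 * H * r powr (\<alpha> - \<nu>)" "r powr c"]
    by (simp add: powr_add mult.assoc mult.commute mult.left_commute)
  have decrease: "H / (3 * fact p) * r powr (q + 1) \<le> f x - f y"
  proof -
    have "L * r powr (real p + \<nu>) \<le> 2 / 3 * H * r powr (q + 1)"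
      using Lr[of "real p + \<nu>"] by (simp add: q_def)
    then have "L / fact p * r powr (real p + \<nu>) \<le> (2 / 3 * H) / fact p * r powr (q + 1)"
      using divide_right_mono[of "L * r powr (real p + \<nu>)" "2 / 3 * H * r powr (q + 1)" "fact p"]
      by simp
    then have "H / (3 * fact p) * r powr (q + 1)
        \<le> H / fact p * r powr (q + 1) - L / fact p * r powr (real p + \<nu>)"
      by (simp add: field_simps)
    also have "\<dots> \<le> f x - f y"
      using trial_point_decrease[OF B f holder nu(1) _ sol] p by (simp add: q_def r_def L_def)
    finally show ?thesis .
  qed
  have grad_le': "g \<le> H * ((2 / 3 * real p + (real p + \<alpha>)) / fact p) * r powr q + \<theta> * r powr q"
  proof -
    have "L / fact (p - 1) * r powr (real p + \<nu> - 1)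
        = real p / fact p * (L * r powr (real p + \<nu> - 1))"
      using fact_pred_real[of p] p by (simp add: field_simps)
    also have "\<dots> \<le> real p / fact p * (2 / 3 * H * r powr q)"
      using Lr[of "real p + \<nu> - 1"] by (intro mult_left_mono) (auto simp: q_def algebra_simps)
    finally have "g \<le> real p / fact p * (2 / 3 * H * r powr q)
        + (H * (real p + \<alpha>) / fact p + \<theta>) * r powr q"
      using grad_le by linarith
    also have "\<dots> = H * ((2 / 3 * real p + (real p + \<alpha>)) / fact p) * r powr q + \<theta> * r powr q"
      by (simp add: add_divide_distrib algebra_simps)
    finally show ?thesis .
  qed
  note fb = fact_real_bounds[OF p]
  have "\<exists>X\<ge>0. X powr ((q + 1) / q) \<le> 8 \<and> g \<le> H * X * r powr q"
  proof (cases known)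
    case True
    let ?X = "(2 * real p + \<alpha>) / fact p"
    have "3 * \<theta> * fact (p - 1) \<le> H" using H(2) True by (simp add: N_const_def Let_def)
    then have "\<theta> \<le> H / 3 * (1 / fact (p - 1))" by (simp add: field_simps)
    moreover have "0 < p" using p by simp
    ultimately have "\<theta> \<le> H / 3 * (real p / fact p)" by (simp only: fact_pred_real)
    from mult_right_mono[OF this, of "r powr q"] grad_le'
    have "g \<le> H * ((2 / 3 * real p + (real p + \<alpha>)) / fact p) * r powr q
        + H / 3 * (real p / fact p) * r powr q" by simp
    also have "\<dots> = H * ?X * r powr q" by (simp add: field_simps)
    finally have "g \<le> H * ?X * r powr q" .
    moreover have "?X powr ((q + 1) / q) \<le> 8"
    proof -
      have "?X \<le> 5 / 2" using fb a01 by (simp add: field_simps)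
      then have "?X powr ((q + 1) / q) \<le> (5 / 2) powr ((q + 1) / q)"
        using a01 q by (intro powr_mono2) auto
      also have "\<dots> \<le> (5 / 2) powr 2" using q by (intro powr_mono) (auto simp: field_simps)
      also have "\<dots> \<le> 8" by (simp add: power2_eq_square)
      finally show ?thesis .
    qed
    ultimately show ?thesis using a01 by (intro exI[of _ ?X]) auto
  next
    case False
    then have a: "\<alpha> = 1" using alpha by (simp add: alpha_def)
    let ?X = "(2 / 3 * real p + (real p + \<alpha>)) / fact p + 1"
    have "\<theta> * r powr q \<le> H * r powr q" using theta_H by (intro mult_right_mono) auto
    then have "g \<le> H * ?X * r powr q" using grad_le' by (simp add: algebra_simps)
    moreover have "?X powr ((q + 1) / q) \<le> 8"
    proof -
      have "?X \<le> 4" using fb a01 by (simp add: field_simps)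
      then have "?X powr ((q + 1) / q) \<le> 4 powr ((q + 1) / q)"
        using a01 q by (intro powr_mono2) auto
      also have "\<dots> \<le> 4 powr (3 / 2)" 
        using p by (intro powr_mono) (auto simp: field_simps q_def a)
      also have "(4::real) powr (3 / 2) = (4 powr (1 / 2)) powr 3" by (simp add: powr_powr)
      also have "\<dots> = 8" by (simp add: powr_half_sqrt)
      finally show ?thesis .
    qed
    ultimately show ?thesis using a01 by (intro exI[of _ ?X]) auto
  qed
  then obtain X where X: "0 \<le> X" "X powr ((q + 1) / q) \<le> 8" "g \<le> H * X * r powr q" by blast
  have "1 / (8 * fact (p + 1) * H powr (1 / q)) * g powr ((q + 1) / q) \<le> f x - f y"
    using p q H(1) X decrease r geps eps by (intro functional_decrease_from_step) auto
  then show ?thesis unfolding accepted_def g_def q_def by simp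
qed

section \<open>Rates of convergence of real sequences\<close>

text \<open>The recursion is a discrete form of \<open>\<xi>' = - \<xi>\<^sup>1\<^sup>+\<^sup>1\<^sup>/\<^sup>q\<close>, along which \<open>\<xi>\<^sup>-\<^sup>1\<^sup>/\<^sup>q\<close> grows at the rate \<open>1/q\<close>.
  In the discrete case each step still contributes \<open>1/(3q)\<close>: the loss is the factor \<open>1 + u\<close>, where
  \<open>u = \<xi>\<^sup>1\<^sup>/\<^sup>q \<le> 2\<close> because of the bound on the initial value.\<close>
lemma sublinear_rate:
  fixes \<xi> :: "nat \<Rightarrow> real" and q :: real
  assumes q: "1 \<le> q" and nonneg: "\<And>k. 0 \<le> \<xi> k" and start: "\<xi> 0 \<le> 2"
    and step: "\<And>k. k < n \<Longrightarrow> \<xi> (Suc k) powr (1 + 1 / q) \<le> \<xi> k - \<xi> (Suc k)"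
    and n: "1 \<le> n"
  shows "\<xi> n \<le> (3 * q / real n) powr q"
proof (cases "\<xi> n = 0")
  case False
  have dec: "\<xi> (Suc k) \<le> \<xi> k" if "k < n" for k
    using step[OF that] powr_ge_zero[of "\<xi> (Suc k)" "1 + 1 / q"] by linarith
  have le2: "\<xi> k \<le> 2" if "k \<le> n" for k
    using that
  proof (induction k)
    case (Suc k)
    then show ?case using dec[of k] by simp
  qed (use start in simp)
  have ge: "\<xi> n \<le> \<xi> (n - k)" if "k \<le> n" for k
    using that
  proof (induction k)
    case (Suc k)
    then have "Suc (n - Suc k) = n - k" by simp
    then show ?case using Suc dec[of "n - Suc k"] by simp
  qed simp
  have pos: "0 < \<xi> k" if "k \<le> n" for k
    using ge[of "n - k"] that nonneg[of n] False by simp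
  have growth: "real k / (3 * q) \<le> \<xi> k powr (- (1 / q))" if "k \<le> n" for k
    using that
  proof (induction k)
    case (Suc k)
    define u where "u = \<xi> (Suc k) powr (1 / q)"
    have p1: "0 < \<xi> (Suc k)" and p0: "0 < \<xi> k" using pos Suc.prems by auto
    have u: "0 < u" using p1 by (simp add: u_def)
    have "u \<le> 2"
    proof -
      have "u \<le> 2 powr (1 / q)" unfolding u_def using le2 Suc.prems p1 q by (intro powr_mono2) auto
      also have "\<dots> \<le> 2 powr 1" using q by (intro powr_mono) auto
      finally show ?thesis by simp
    qed
    have "\<xi> (Suc k) * (1 + u) \<le> \<xi> k"
      using step[of k] Suc.prems p1 by (simp add: u_def powr_add algebra_simps)
    then have "\<xi> k powr (- (1 / q)) \<le> (\<xi> (Suc k) * (1 + u)) powr (- (1 / q))"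
      using p1 u q by (intro powr_mono2') auto
    also have "\<dots> = (1 / u) * (1 / (1 + u)) powr (1 / q)"
      using p1 u by (simp add: powr_mult powr_minus_divide powr_divide u_def)
    also have "\<dots> \<le> (1 / u) * (1 - u / (q * (1 + u)))"
    proof (rule mult_left_mono)
      \<comment> \<open>Concavity of the power \<open>1/q\<close>, as the weighted arithmetic-geometric mean inequality with \<open>1\<close>.\<close>
      have "(1 / (1 + u)) powr (1 / q) * 1 powr (1 - 1 / q) \<le> 1 / q * (1 / (1 + u)) + (1 - 1 / q) * 1"
        using q u by (intro Youngs_inequality_0) auto
      also have "\<dots> = 1 - u / (q * (1 + u))"
      proof -
        have "1 / (1 + u) = 1 - u / (1 + u)" using u by (simp add: field_simps)
        then show ?thesis by (simp only:) (simp add: right_diff_distrib)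
      qed
      finally show "(1 / (1 + u)) powr (1 / q) \<le> 1 - u / (q * (1 + u))" by simp
    qed (use u in simp)
    also have "\<dots> = 1 / u - 1 / (q * (1 + u))" using u q by (simp add: field_simps)
    also have "\<dots> \<le> 1 / u - 1 / (q * 3)"
      using \<open>u \<le> 2\<close> u q by (intro diff_left_mono divide_left_mono mult_left_mono) auto
    finally have "\<xi> k powr (- (1 / q)) + 1 / (3 * q) \<le> \<xi> (Suc k) powr (- (1 / q))"
      by (simp add: u_def powr_minus_divide mult.commute)
    then show ?case using Suc by (simp add: add_divide_distrib)
  qed simp
  have "\<xi> n = (\<xi> n powr (- (1 / q))) powr (- q)"
    using pos[of n] q by (simp add: powr_powr)
  also have "\<dots> \<le> (real n / (3 * q)) powr (- q)"
    using growth[of n] n q by (intro powr_mono2') auto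
  also have "\<dots> = (3 * q / real n) powr q"
    using n q by (simp add: powr_minus powr_divide)
  finally show ?thesis .
qed simp

text \<open>The gap \<open>\<delta>\<close> and the gradient norm \<open>g\<close> are treated over three blocks of \<open>s\<close> steps. Eliminating
  \<open>g\<close> gives a recursion for \<open>\<delta>\<close>, so that after two blocks \<open>\<delta>\<close> is \<open>O(s\<^sup>-\<^sup>q)\<close>. During the last block the
  decreases, each at least of the order \<open>G\<^sup>1\<^sup>+\<^sup>1\<^sup>/\<^sup>q\<close>, sum to at most this remaining gap. The extra
  factor \<open>1/s\<close> obtained in this way makes \<open>G\<close> of the order \<open>s\<^sup>-\<^sup>q\<close>; a single step would give only the
  exponent \<open>q\<^sup>2 / (q + 1)\<close> in place of \<open>q\<close>.\<close>
lemma gradient_rate: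
  fixes \<delta> g :: "nat \<Rightarrow> real" and q K M D G :: real and s :: nat
  assumes q: "1 \<le> q" and pos: "0 < K" "0 < M" "0 < D" and s: "1 \<le> s"
    and \<delta>: "\<And>k. 0 \<le> \<delta> k" and start: "\<delta> 0 \<le> 4 * K powr q * M * D powr (q + 1)"
    and decrease: "\<And>k. k < 3 * s \<Longrightarrow>
        1 / (K * (2 * M) powr (1 / q)) * g (Suc k) powr (1 + 1 / q) \<le> \<delta> k - \<delta> (Suc k)"
    and g: "\<And>k. k < 3 * s \<Longrightarrow> \<delta> (Suc k) \<le> D * g (Suc k)"
    and G: "0 \<le> G" "\<And>k. k < 3 * s \<Longrightarrow> G \<le> g (Suc k)"
  shows "G \<le> 2 * M * (K * D * (3 * q / 2) / real s) powr q"
proof -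
  define C where "C = 1 / (K * (2 * M) powr (1 / q))"
  \<comment> \<open>The scale on which \<open>\<delta> / \<Lambda>\<close> satisfies the recursion with constant \<open>1\<close>.\<close>
  define \<Lambda> where "\<Lambda> = K powr q * (2 * M) * D powr (q + 1)"
  have C: "0 < C" using pos by (simp add: C_def)
  have \<Lambda>: "0 < \<Lambda>" using pos by (simp add: \<Lambda>_def)
  have e: "(q + 1) / q = 1 + 1 / q" using q by (simp add: field_simps)
  have \<Lambda>_root: "\<Lambda> powr (1 / q) = D powr (1 + 1 / q) / C"
    using pos q by (simp add: \<Lambda>_def C_def powr_mult powr_powr e[symmetric])
  have "\<delta> (2 * s) / \<Lambda> \<le> (3 * q / real (2 * s)) powr q"
  proof (rule sublinear_rate[OF q])
    show "0 \<le> \<delta> k / \<Lambda>" for k using \<delta> \<Lambda> by simp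
    show "\<delta> 0 / \<Lambda> \<le> 2" using start \<Lambda> by (simp add: \<Lambda>_def field_simps)
    fix k assume "k < 2 * s"
    then have k: "k < 3 * s" by simp
    have "\<delta> (Suc k) powr (1 + 1 / q) \<le> (D * g (Suc k)) powr (1 + 1 / q)"
      using \<delta> g[OF k] q by (intro powr_mono2) auto
    also have "\<dots> = D powr (1 + 1 / q) / C * (C * g (Suc k) powr (1 + 1 / q))"
      using C pos G(1) G(2)[OF k] by (simp add: powr_mult)
    also have "\<dots> \<le> D powr (1 + 1 / q) / C * (\<delta> k - \<delta> (Suc k))"
      using C decrease[OF k] by (intro mult_left_mono) (auto simp: C_def)
    finally have "\<delta> (Suc k) powr (1 + 1 / q) \<le> \<Lambda> powr (1 / q) * (\<delta> k - \<delta> (Suc k))"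
      by (simp add: \<Lambda>_root)
    then show "(\<delta> (Suc k) / \<Lambda>) powr (1 + 1 / q) \<le> \<delta> k / \<Lambda> - \<delta> (Suc k) / \<Lambda>"
      using \<Lambda> \<delta> by (simp add: powr_divide powr_add field_simps)
  qed (use s in simp)
  then have \<delta>_mid: "\<delta> (2 * s) \<le> \<Lambda> * ((3 * q / 2) / real s) powr q"
    using \<Lambda> by (simp add: field_simps)
  have "real s * (C * G powr (1 + 1 / q)) = (\<Sum>k\<in>{2 * s ..< 3 * s}. C * G powr (1 + 1 / q))" by simp
  also have "\<dots> \<le> (\<Sum>k\<in>{2 * s ..< 3 * s}. \<delta> k - \<delta> (Suc k))"
  proof (rule sum_mono)
    fix k assume "k \<in> {2 * s ..< 3 * s}"
    then have k: "k < 3 * s" by simp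
    have "C * G powr (1 + 1 / q) \<le> C * g (Suc k) powr (1 + 1 / q)"
      using C G(1) G(2)[OF k] q by (intro mult_left_mono powr_mono2) auto
    then show "C * G powr (1 + 1 / q) \<le> \<delta> k - \<delta> (Suc k)"
      using decrease[OF k] by (simp add: C_def)
  qed
  also have "\<dots> = \<delta> (2 * s) - \<delta> (3 * s)"
    using sum_Suc_diff'[of "2 * s" "3 * s" "\<lambda>k. - \<delta> k"] by simp
  also have "\<dots> \<le> \<delta> (2 * s)" using \<delta> by simp
  also note \<delta>_mid
  finally have G_pow: "G powr (1 + 1 / q) \<le> \<Lambda> * ((3 * q / 2) / real s) powr q / (C * real s)"
    using C s by (simp add: field_simps)
  define W where "W = 2 * M * (K * D * (3 * q / 2) / real s) powr q"
  have W: "0 < W" using pos q s by (simp add: W_def)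
  have "\<Lambda> * ((3 * q / 2) / real s) powr q / (C * real s)
      \<le> \<Lambda> * ((3 * q / 2) / real s) powr q / (C * real s) * (3 * q / 2)"
    (is "?X \<le> ?X * _")
  proof -
    have "0 \<le> ?X" by (intro divide_nonneg_nonneg mult_nonneg_nonneg) (use \<Lambda> C in auto)
    from mult_left_mono[OF _ this, of 1 "3 * q / 2"] q show ?thesis by simp
  qed
  also have "\<dots> = W powr (1 + 1 / q)"
  proof -
    have "W powr (1 + 1 / q) = (2 * M) powr (1 + 1 / q) * (K * D * (3 * q / 2) / real s) powr (q + 1)"
      unfolding W_def using pos q s by (simp add: powr_mult powr_powr e[symmetric])
    also have "\<dots> = (2 * M) * (2 * M) powr (1 / q) * (K powr q * K * (D powr (q + 1)) 
        * (((3 * q / 2) / real s) powr q * ((3 * q / 2) / real s)))"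
    proof -
      have "(K * D * (3 * q / 2) / real s) powr (q + 1)
          = K powr (q + 1) * D powr (q + 1) * ((3 * q / 2) / real s) powr (q + 1)"
        using pos q s powr_mult[of "K * D" "(3 * q / 2) / real s" "q + 1"] powr_mult[of K D "q + 1"]
        by simp
      then show ?thesis using pos q s by (simp add: powr_add)
    qed
    finally show ?thesis by (simp add: \<Lambda>_def C_def field_simps)
  qed
  finally have "G powr (1 + 1 / q) \<le> W powr (1 + 1 / q)" using G_pow by linarith
  moreover have "W powr (1 + 1 / q) < G powr (1 + 1 / q)" if "W < G"
    using that W q by (intro powr_less_mono2) (auto intro: add_pos_pos)
  ultimately show ?thesis unfolding W_def[symmetric] by force
qed

lemma convex_gradient_inequality:
  fixes f :: "'a::euclidean_space \<Rightarrow> real"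
  assumes convex: "convex_on UNIV f" and diff: "f differentiable (at y)"
  shows "f y - f z \<le> blinfun_apply (grad f y) (y - z)"
proof -
  let ?\<phi> = "\<lambda>t. f (y + t *\<^sub>R (z - y))"
  have D: "(f has_derivative blinfun_apply (grad f y)) (at y)"
    using diff frechet_derivative_works grad_apply by metis
  have conv: "convex_on UNIV ?\<phi>"
  proof (rule convex_onI)
    fix t a b :: real assume "0 < t" "t < 1"
    have "y + ((1 - t) *\<^sub>R a + t *\<^sub>R b) *\<^sub>R (z - y)
        = (1 - t) *\<^sub>R (y + a *\<^sub>R (z - y)) + t *\<^sub>R (y + b *\<^sub>R (z - y))"
      by (simp add: algebra_simps)
    then show "?\<phi> ((1 - t) *\<^sub>R a + t *\<^sub>R b) \<le> (1 - t) * ?\<phi> a + t * ?\<phi> b"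
      using convex_onD[OF convex, of t "y + a *\<^sub>R (z - y)" "y + b *\<^sub>R (z - y)"] \<open>0 < t\<close> \<open>t < 1\<close> by simp
  qed simp
  have "((\<lambda>t. y + t *\<^sub>R (z - y)) has_derivative (\<lambda>u. u *\<^sub>R (z - y))) (at 0)"
    by (auto intro!: derivative_eq_intros)
  from has_derivative_compose[OF this, of f "blinfun_apply (grad f y)"] D
  have "(?\<phi> has_derivative (\<lambda>u. u * blinfun_apply (grad f y) (z - y))) (at 0)"
    by (simp add: blinfun.scaleR_right)
  then have "(?\<phi> has_real_derivative blinfun_apply (grad f y) (z - y)) (at 0)"
    by (simp add: has_field_derivative_def mult_commute_abs)
  with convex_on_imp_above_tangent[OF conv, of 0 1]
  have "blinfun_apply (grad f y) (z - y) \<le> f z - f y" by simp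
  then show ?thesis by (simp add: blinfun.diff_right)
qed

section \<open>Iteration complexity\<close>

lemma two_powi_pred: "(2::real) powi (int n - 1) = 2 ^ n / 2"
  by (simp add: power_int_diff)

text \<open>If the line search needed more than one trial, its last but one trial was rejected, so the
  coefficient was then below \<open>N\<^sub>\<nu>(\<epsilon>)\<close>, and it was doubled once. Halving the accepted coefficient for
  the next iteration keeps the invariant \<open>H t \<le> M\<close>.\<close>
lemma algorithm_run_regularization_le:
  fixes B :: "'a::euclidean_space \<Rightarrow> 'a \<Rightarrow>\<^sub>L real"
  assumes B: "self_adjoint_pos_def B" and f: "times_differentiable p f"
    and holder: "holder_const B f p \<nu> < \<infinity>" and nu: "0 \<le> \<nu>" "\<nu> \<le> 1" and p: "2 \<le> p"
    and alpha: "\<alpha> = alpha known \<nu>" and H0: "0 < H0" and theta: "0 \<le> \<theta>" and eps: "0 < \<epsilon>" "\<epsilon> < 1"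
    and run: "algorithm_run B f \<alpha> p \<theta> \<epsilon> x0 H0 T x H xp it"
    and M: "H0 \<le> M" "N_const B f p \<nu> known \<theta> \<epsilon> \<le> M"
    and t: "t \<le> T"
  shows "0 < H t \<and> 2 ^ it t * H t \<le> 2 * M"
proof -
  have trial_le: "2 ^ it t * H t \<le> 2 * M" if "t \<le> T" "0 < H t" "H t \<le> M" for t
  proof (cases "it t")
    case 0
    then show ?thesis using that by simp
  next
    case (Suc i)
    have "approx_solution B f \<alpha> p \<theta> (2 ^ i * H t) (x t) (xp t i)"
      and "\<not> accepted B f \<alpha> p \<epsilon> (2 ^ i * H t) (x t) (xp t i)"
      using run \<open>t \<le> T\<close> Suc unfolding algorithm_run_def by auto
    moreover have "0 < 2 ^ i * H t" using that by simp
    ultimately have "\<not> N_const B f p \<nu> known \<theta> \<epsilon> \<le> 2 ^ i * H t"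
      using trial_point_accepted[OF B f holder nu p alpha _ _ theta eps] by blast
    then show ?thesis using M(2) Suc by simp
  qed
  have "0 < H t \<and> H t \<le> M" using t
  proof (induction t)
    case 0
    then show ?case using run H0 M unfolding algorithm_run_def by simp
  next
    case (Suc t)
    have "H (Suc t) = 2 ^ it t * H t / 2"
      using run Suc.prems unfolding algorithm_run_def by (simp add: two_powi_pred)
    moreover have "0 < 2 ^ it t * H t" "2 ^ it t * H t \<le> 2 * M"
      using Suc trial_le[of t] by auto
    ultimately show ?case by simp
  qed
  then show ?thesis using trial_le[OF t] by blast
qed

lemma iteration_count_from_gradient_bound:
  fixes A n q M \<epsilon> :: real
  assumes pos: "0 < A" "0 < n" "0 < q" "0 < M" "0 < \<epsilon>"
    and less: "\<epsilon> < 2 * (A / n) powr q * M"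
  shows "n < (2 * M) powr (1 / q) * A * \<epsilon> powr (- (1 / q))"
proof -
  have "\<epsilon> powr (1 / q) < ((2 * M) * (A / n) powr q) powr (1 / q)"
    using pos less by (intro powr_less_mono2) (auto simp: ac_simps)
  also have "\<dots> = (2 * M) powr (1 / q) * (A / n)"
    using pos powr_mult[of "2 * M" "(A / n) powr q" "1 / q"] by (simp add: powr_powr)
  finally have "\<epsilon> powr (1 / q) * n < (2 * M) powr (1 / q) * A"
    using pos by (simp add: field_simps)
  then show ?thesis using pos by (simp add: powr_minus_divide pos_less_divide_eq mult.commute)
qed

text \<open>For unknown \<open>\<nu>\<close> the power of \<open>\<epsilon>\<close> inside \<open>N\<^sub>\<nu>(\<epsilon>)\<close> combines with \<open>\<epsilon>\<^sup>-\<^sup>1\<^sup>/\<^sup>p\<close>; it can be factored out of the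
  maximum with \<open>H0\<close> because \<open>\<epsilon> < 1\<close>.\<close>
lemma complexity_constant:
  assumes nu: "0 \<le> \<nu>" "\<nu> \<le> 1" and p: "2 \<le> p" and H0: "0 < H0" and eps: "0 < \<epsilon>" "\<epsilon> < 1"
    and M: "M = max H0 (N_const B f p \<nu> known \<theta> \<epsilon>)"
    and q: "q = real p + alpha known \<nu> - 1"
  shows "(2 * M) powr (1 / q) * \<epsilon> powr (- (1 / q))
       \<le> kappa1 B f p \<nu> known \<theta> H0 * \<epsilon> powr (- (1 / (real p + \<nu> - 1)))"
proof (cases known)
  case True
  then show ?thesis by (simp add: M q N_const_def kappa1_def Let_def alpha_def)
next
  case False
  define \<omega> where "\<omega> = real p + \<nu> - 1"
  define k where "k = (1 - \<nu>) / \<omega>"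
  define b where "b = (3 * enn2real (holder_const B f p \<nu>) / 2) powr (real p / \<omega>) * 4 powr k"
  define c where "c = max H0 (max \<theta> b)"
  have \<omega>: "1 \<le> \<omega>" using nu p by (simp add: \<omega>_def)
  have k: "0 \<le> k" using nu \<omega> by (simp add: k_def)
  have qp: "q = real p" using False q by (simp add: alpha_def)
  have c: "0 < c" using H0 by (simp add: c_def less_max_iff_disj)
  have eps_ge: "1 \<le> \<epsilon> powr (- k)"
  proof -
    have "\<epsilon> powr k \<le> 1" using k eps by (intro powr_le1) auto
    then show ?thesis using eps by (simp add: powr_minus one_le_inverse)
  qed
  have M_le: "M \<le> c * \<epsilon> powr (- k)"
  proof -
    have "M = max H0 (max \<theta> b * \<epsilon> powr (- k))"
      using False by (simp add: M N_const_def Let_def b_def k_def \<omega>_def)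
    moreover have "H0 * 1 \<le> c * \<epsilon> powr (- k)"
      using eps_ge H0 c by (intro mult_mono) (auto simp: c_def)
    moreover have "max \<theta> b * \<epsilon> powr (- k) \<le> c * \<epsilon> powr (- k)"
      by (intro mult_right_mono) (auto simp: c_def)
    ultimately show ?thesis by simp
  qed
  have M_pos: "0 < M" using H0 M by simp
  have "(2 * M) powr (1 / q) \<le> ((2 * c) * \<epsilon> powr (- k)) powr (1 / q)"
    using M_le M_pos p qp by (intro powr_mono2) auto
  also have "\<dots> = (2 * c) powr (1 / q) * \<epsilon> powr (- (k / q))"
    using c by (simp add: powr_mult powr_powr)
  finally have "(2 * M) powr (1 / q) * \<epsilon> powr (- (1 / q))
      \<le> (2 * c) powr (1 / q) * \<epsilon> powr (- (k / q)) * \<epsilon> powr (- (1 / q))"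
    by (rule mult_right_mono) simp
  also have "\<dots> = (2 * c) powr (1 / q) * \<epsilon> powr (- (k / q) + - (1 / q))"
    by (simp only: powr_add mult.assoc)
  also have "- (k / q) + - (1 / q) = - (1 / \<omega>)"
  proof -
    have "k + 1 = q / \<omega>" using \<omega> by (simp add: k_def qp field_simps) (simp add: \<omega>_def)
    then have "(k + 1) / q = 1 / \<omega>" using p qp by simp
    then show ?thesis by (simp add: add_divide_distrib)
  qed
  also have "(2 * c) powr (1 / q) = kappa1 B f p \<nu> known \<theta> H0"
    using False by (simp add: kappa1_def Let_def qp c_def b_def k_def \<omega>_def)
  finally show ?thesis by (simp add: \<omega>_def)
qed

theorem theorem3p3:
  fixes B :: "'a::euclidean_space \<Rightarrow> 'a \<Rightarrow>\<^sub>L real"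
    and f :: "'a \<Rightarrow> real"
    and p m T s :: nat
    and \<nu> \<theta> \<epsilon> H0 D0 \<alpha> M :: real
    and known :: bool
    and x0 xstar :: 'a
    and x :: "nat \<Rightarrow> 'a" and H :: "nat \<Rightarrow> real"
    and xp :: "nat \<Rightarrow> nat \<Rightarrow> 'a" and it :: "nat \<Rightarrow> nat"
  assumes alpha: "\<alpha> = alpha known \<nu>"
    and M: "M = max H0 (N_const B f p \<nu> known \<theta> \<epsilon>)"
    and B: "self_adjoint_pos_def B"
    and p: "p \<ge> 2"
    and convex: "convex_on UNIV f"
    and diff: "times_differentiable p f"
    and minimizer: "\<And>y. f xstar \<le> f y"
    and nu: "0 \<le> \<nu>" "\<nu> \<le> 1"
    and holder: "holder_const B f p \<nu> < \<infinity>"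
    and D0: "1 < D0" "\<And>y. f y \<le> f x0 \<Longrightarrow> pnorm B (y - xstar) \<le> D0"
    and params: "H0 > 0" "\<theta> \<ge> 0" "0 < \<epsilon>" "\<epsilon> < 1"
    and run: "algorithm_run B f \<alpha> p \<theta> \<epsilon> x0 H0 T x H xp it"
    and large_grad: "\<And>t i. t \<le> T \<Longrightarrow> i \<le> it t \<Longrightarrow> dnorm B (grad f (xp t i)) > \<epsilon>"
    and m_bound: "f (x m) - f xstar
          \<le> 4 * (8 * fact (p + 1)) powr (real p + \<alpha> - 1) * M * D0 powr (real p + \<alpha>)"
    and m_first: "\<And>t. t < m \<Longrightarrow> \<not> f (x t) - f xstar
          \<le> 4 * (8 * fact (p + 1)) powr (real p + \<alpha> - 1) * M * D0 powr (real p + \<alpha>)"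
    and m: "m < T"
    and T: "T = m + 3 * s" "s \<ge> 1"
  shows "Min ((\<lambda>t. dnorm B (grad f (x t))) ` {0..T})
           \<le> 2 * (288 * real p * fact (p + 1) * D0 / (real T - real m)) powr (real p + \<alpha> - 1) * M
         \<and> real T < real m + kappa1 B f p \<nu> known \<theta> H0 * (288 * real p * fact (p + 1) * D0)
                            * \<epsilon> powr (- (1 / (real p + \<nu> - 1)))"
proof -
  define q where "q = real p + \<alpha> - 1"
  define K where "K = (8 * fact (p + 1) :: real)"
  define g where "g = (\<lambda>t. dnorm B (grad f (x t)))"
  define \<delta> where "\<delta> = (\<lambda>t. f (x t) - f xstar)"
  define G where "G = Min (g ` {0..T})"
  define A where "A = 288 * real p * fact (p + 1) * D0"
  have alpha01: "0 \<le> \<alpha>" "\<alpha> \<le> 1" using alpha nu by (auto simp: alpha_def)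
  have q: "1 \<le> q" "q \<le> real p" using alpha01 p by (auto simp: q_def)
  have q_Suc: "q + 1 = real p + \<alpha>" by (simp add: q_def)
  have K: "0 < K" by (simp add: K_def)
  have Mpos: "0 < M" and M_ge: "H0 \<le> M" "N_const B f p \<nu> known \<theta> \<epsilon> \<le> M"
    using M params(1) by auto
  have A: "0 < A" using p D0(1) by (simp add: A_def)
  have g_nonneg: "0 \<le> g t" for t by (simp add: g_def B)
  note H_le = algorithm_run_regularization_le[OF B diff holder nu p alpha params(1,2,3,4) run M_ge]

  have decrease: "1 / (K * (2 * M) powr (1 / q)) * g (Suc t) powr (1 + 1 / q) \<le> \<delta> t - \<delta> (Suc t)"
    if t: "t \<le> T" for t
  proof -
    define h where "h = 2 ^ it t * H t"
    have h: "0 < h" "h \<le> 2 * M" using H_le[OF t] by (auto simp: h_def)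
    have step: "x (Suc t) = xp t (it t)" and acc: "accepted B f \<alpha> p \<epsilon> h (x t) (x (Suc t))"
      using run t unfolding algorithm_run_def h_def by auto
    have e: "(real p + \<alpha>) / (real p + \<alpha> - 1) = 1 + 1 / q"
      using q by (simp add: q_def field_simps)
    have "1 / (K * (2 * M) powr (1 / q)) \<le> 1 / (K * h powr (1 / q))"
      using h K q Mpos by (intro divide_left_mono mult_left_mono powr_mono2) auto
    then have "1 / (K * (2 * M) powr (1 / q)) * g (Suc t) powr (1 + 1 / q)
        \<le> 1 / (K * h powr (1 / q)) * g (Suc t) powr (1 + 1 / q)"
      by (rule mult_right_mono) simp
    also have "\<dots> \<le> f (x t) - f (x (Suc t))"
      using acc large_grad[OF t order_refl] unfolding accepted_def e step
      by (simp add: K_def q_def g_def step)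
    finally show ?thesis by (simp add: \<delta>_def)
  qed
  have level: "f (x t) \<le> f x0" if "t \<le> Suc T" for t
    using that
  proof (induction t)
    case 0
    then show ?case using run by (simp add: algorithm_run_def)
  next
    case (Suc t)
    have "0 \<le> 1 / (K * (2 * M) powr (1 / q)) * g (Suc t) powr (1 + 1 / q)" using K by simp
    then have "\<delta> (Suc t) \<le> \<delta> t" using decrease[of t] Suc.prems by linarith
    then show ?case using Suc by (simp add: \<delta>_def)
  qed
  have gap: "\<delta> t \<le> D0 * g t" if "t \<le> Suc T" for t
  proof -
    have "f differentiable (at (x t))"
      using diff p unfolding times_differentiable_def by (metis Dform.simps(1) list.size(3) zero_less_numeral less_le_trans)
    then have "\<delta> t \<le> blinfun_apply (grad f (x t)) (x t - xstar)"
      unfolding \<delta>_def by (rule convex_gradient_inequality[OF convex])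
    also have "\<dots> \<le> g t * pnorm B (x t - xstar)"
      using abs_apply_le_dnorm[OF B] abs_le_D1 unfolding g_def by blast
    also have "\<dots> \<le> g t * D0" using D0(2)[OF level[OF that]] g_nonneg by (rule mult_left_mono)
    finally show ?thesis by (simp add: mult.commute)
  qed
  have G_le: "G \<le> g t" if "t \<le> T" for t
    unfolding G_def using that by (intro Min_le) auto
  have "G \<in> g ` {0..T}" unfolding G_def by (intro Min_in) auto
  then obtain t where t: "t \<le> T" "G = g t" by auto
  then have G: "0 \<le> G" "\<epsilon> < G" using run g_nonneg unfolding algorithm_run_def g_def by auto

  \<comment> \<open>The three blocks of iterations are \<open>m, \<dots>, m + 3 s = T\<close>.\<close>
  have "G \<le> 2 * M * (K * D0 * (3 * q / 2) / real s) powr q"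
  proof (rule gradient_rate[OF q(1) K Mpos _ T(2), where \<delta> = "\<lambda>k. \<delta> (m + k)" and g = "\<lambda>k. g (m + k)"])
    show "0 \<le> \<delta> (m + k)" for k using minimizer by (simp add: \<delta>_def)
    show "\<delta> (m + 0) \<le> 4 * K powr q * M * D0 powr (q + 1)"
      using m_bound by (simp add: \<delta>_def K_def q_def)
    show "1 / (K * (2 * M) powr (1 / q)) * g (m + Suc k) powr (1 + 1 / q)
        \<le> \<delta> (m + k) - \<delta> (m + Suc k)" if "k < 3 * s" for k
      using decrease[of "m + k"] that T by simp
    show "\<delta> (m + Suc k) \<le> D0 * g (m + Suc k)" if "k < 3 * s" for k
      using gap[of "m + Suc k"] that T by simp
    show "G \<le> g (m + Suc k)" if "k < 3 * s" for k
      using G_le[of "m + Suc k"] that T by simp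
  qed (use D0 G in auto)
  also have "\<dots> \<le> 2 * M * (A / (real T - real m)) powr q"
  proof (intro mult_left_mono powr_mono2)
    have "K * D0 * (3 * q / 2) / real s = 36 * q * fact (p + 1) * D0 / (3 * real s)"
      using T(2) by (simp add: K_def)
    also have "\<dots> \<le> A / (3 * real s)"
      unfolding A_def using q D0(1) by (intro divide_right_mono mult_right_mono mult_mono) auto
    finally show "K * D0 * (3 * q / 2) / real s \<le> A / (real T - real m)" using T by simp
  qed (use q K D0(1) Mpos in auto)
  finally have rate: "G \<le> 2 * (A / (real T - real m)) powr q * M" by (simp add: ac_simps)

  have "real T - real m < (2 * M) powr (1 / q) * A * \<epsilon> powr (- (1 / q))"
    using rate G(2) A m q Mpos params(3) by (intro iteration_count_from_gradient_bound) auto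
  also have "\<dots> = (2 * M) powr (1 / q) * \<epsilon> powr (- (1 / q)) * A" by (simp add: ac_simps)
  also have "\<dots> \<le> kappa1 B f p \<nu> known \<theta> H0 * \<epsilon> powr (- (1 / (real p + \<nu> - 1))) * A"
    using complexity_constant[OF nu p params(1,3,4) M q_def[unfolded alpha]] A
    by (intro mult_right_mono) auto
  finally have "real T < real m + kappa1 B f p \<nu> known \<theta> H0 * A * \<epsilon> powr (- (1 / (real p + \<nu> - 1)))"
    by (simp add: ac_simps)
  with rate show ?thesis unfolding G_def g_def A_def q_def by blast
qed

end
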